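(* Let $d$ and $k$ be integers with $0\leq k\leq d-1$, and let $S_0,S_1,\ldots,S_k$ be finite sets, each consisting of $d-k+2$ points in $\mathbb{R}^d$. Then every set $S_i$ ($0\le i\le k$) can be split into $2$ sets $S_{i1}$ and $S_{i2}$ so that there is a $k$-flat $F$ in $\mathbb{R}^d$ meeting all the sets $\mathrm{conv}\, S_{ij}$, i.e. $F\cap \mathrm{conv}\, S_{ij}\neq\emptyset$ for all $0\leq i\leq k$ and $j\in\{1,2\}$.
   Context: A $k$-flat in $\mathbb{R}^d$ is a $k$-dimensional affine subspace of $\mathbb{R}^d$ (a single point when $k=0$). $\mathrm{conv}$ denotes the convex hull. "Split into $2$ sets" means partitioned: $S_i=S_{i1}\cup S_{i2}$ with $S_{i1}\cap S_{i2}=\emptyset$ (both parts are then nonempty, since $F$ meets both of their convex hulls). *)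

theory Defs
  imports "HOL-Analysis.Analysis"
begin

definition k_flat :: "nat \<Rightarrow> 'a::euclidean_space set \<Rightarrow> bool" where
  "k_flat k F \<longleftrightarrow> affine F \<and> aff_dim F = int k"

end

theory Submission
  imports Defs "HOL-Library.Z2"
begin

text \<open>
  Put \<open>m = d - k\<close>. A real vector \<open>l\<^sub>i\<close> on the \<open>m + 2\<close> points of \<open>S\<^sub>i\<close> with coordinate sum \<open>0\<close> encodes a
  splitting together with a point in each of the two hulls, and orthogonal vectors
  \<open>Y\<^sub>0, \<dots>, Y\<^sub>m\<^sub>-\<^sub>1\<close> encode the direction of a \<open>k\<close>-flat. That the \<open>2 (k + 1)\<close> points lie on one such
  flat, together with the orthogonality of the \<open>Y\<^sub>r\<close>, is a square system of equations on a product
  of spheres: \<open>Y\<^sub>r\<close> ranges over the unit sphere of the span of the first \<open>k + r + 1\<close> basis vectors.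
  Every equation is odd or even in each sphere variable. If the spheres are ordered
  \<open>Y\<^sub>0, \<dots>, Y\<^sub>m\<^sub>-\<^sub>1, l\<^sub>0, \<dots>, l\<^sub>k\<close>, the equations can be distributed to the spheres, as many to each as
  its dimension, such that each is odd in its own variable and even in all later ones. Mod 2 the
  Euler class of such a triangular system is nonzero, so there is a solution.

  The solution is found combinatorially. Each sphere is replaced by a hemisphere, i.e. a cube with
  antipodal boundary points identified up to sign. On a grid in the product of the cubes, the Euler
  class is a sum over maximal flags of cells of a cup product of 1-cocycles; this sum depends only on
  the parities, equals 1 for an explicit choice, and would vanish if the system had no solution.
\<close>

subsection \<open>Cup products of coboundaries modulo 2\<close>

declare add_bit_eq_xor [simp del] mult_bit_eq_and [simp del]

lemma bit_add_self [simp]: "x + x = (0::bit)"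
  by (cases x) (auto simp: add_bit_eq_xor)

lemma bit_add_self_left [simp]: "x + (x + y) = (y::bit)"
  by (simp add: add.assoc [symmetric])

lemma bit_add_eq_0_iff [simp]: "x + y = (0::bit) \<longleftrightarrow> x = y"
  by (metis add.right_neutral bit_add_self_left bit_add_self)

lemma bit_add_eq_1_iff: "x + y = (1::bit) \<longleftrightarrow> x \<noteq> y"
  by (metis bit_add_eq_0_iff bit_not_zero_iff zero_neq_one)

text \<open>The orbits of \<open>\<phi>\<close> are pairs on which \<open>g\<close> is constant, and
  each pair adds up to 0 modulo 2.\<close>

lemma sum_bit_involution:
  fixes g :: "'a \<Rightarrow> bit"
  assumes "finite A"
    and "\<And>x. x \<in> A \<Longrightarrow> \<phi> x \<in> A \<and> \<phi> (\<phi> x) = x \<and> \<phi> x \<noteq> x \<and> g (\<phi> x) = g x"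
  shows "sum g A = 0"
  using assms
proof (induction A rule: finite_psubset_induct)
  case (psubset A)
  show ?case
  proof (cases "A = {}")
    case False
    then obtain x where x: "x \<in> A" by blast
    let ?B = "A - {x, \<phi> x}"
    have "sum g ?B = 0"
    proof (rule psubset.IH)
      show "?B \<subset> A" using x by blast
      fix y assume y: "y \<in> ?B"
      then have "\<phi> y \<noteq> x" "\<phi> y \<noteq> \<phi> x"
        using psubset.prems[OF x] psubset.prems[of y] by auto
      then show "\<phi> y \<in> ?B \<and> \<phi> (\<phi> y) = y \<and> \<phi> y \<noteq> y \<and> g (\<phi> y) = g y"
        using psubset.prems[of y] y by auto
    qed
    moreover have "sum g A = sum g {x, \<phi> x} + sum g ?B"
      using x psubset.prems[OF x] psubset.hyps
      by (subst sum.union_disjoint [symmetric]) (auto intro: sum.cong)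
    ultimately show ?thesis using psubset.prems[OF x] by auto
  qed simp
qed

text \<open>The face operators of a simplex: a flag is a simplex of the barycentric subdivision, and
  \<open>omit i\<close> drops its \<open>i\<close>-th vertex.\<close>

definition omit :: "nat \<Rightarrow> (nat \<Rightarrow> 'a) \<Rightarrow> nat \<Rightarrow> 'a" where
  "omit i F j = (if j < i then F j else F (Suc j))"

text \<open>A cup product of coboundaries is a cocycle. So on the simplex
  \<open>F 0, ..., F (n + 1)\<close> the first \<open>n + 1\<close> faces add up to the last one,
  whose value is the right-hand side.\<close>

lemma sum_omit_front:
  fixes a :: "nat \<Rightarrow> 'a \<Rightarrow> bit"
  shows "(\<Sum>i\<le>n. \<Prod>j<n. a j (omit i F j) + a j (omit i F (Suc j)))
    = (\<Prod>j<n. a j (F j) + a j (F (Suc j)))"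
proof (induction n)
  case (Suc n)
  let ?e = "\<lambda>j. a j (F j) + a j (F (Suc j))"
  have 1: "(\<Sum>i\<le>n. \<Prod>j<Suc n. a j (omit i F j) + a j (omit i F (Suc j)))
    = (\<Prod>j<n. ?e j) * (a n (F (Suc n)) + a n (F (Suc (Suc n))))"
    unfolding Suc.IH [symmetric] sum_distrib_right
    by (rule sum.cong) (auto simp: omit_def)
  have 2: "(\<Prod>j<Suc n. a j (omit (Suc n) F j) + a j (omit (Suc n) F (Suc j)))
    = (\<Prod>j<n. ?e j) * (a n (F n) + a n (F (Suc (Suc n))))"
    by (simp add: omit_def)
  show ?case
    unfolding sum.atMost_Suc 1 2 distrib_left [symmetric] by (simp add: ac_simps)
qed simp

text \<open>The mirror image on the vertices \<open>F k, ..., F (n + 1)\<close>: all faces but the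
  first add up to the first. Hence the induction lowers \<open>k\<close>, adding vertices in
  front.\<close>

lemma sum_omit_back:
  fixes a :: "nat \<Rightarrow> 'a \<Rightarrow> bit"
  assumes "k \<le> n"
  shows "(\<Sum>i\<in>{k..n}. \<Prod>j\<in>{k..<n}. a j (omit (Suc i) F j) + a j (omit (Suc i) F (Suc j)))
    = (\<Prod>j\<in>{k..<n}. a j (F (Suc j)) + a j (F (Suc (Suc j))))"
  using assms
proof (induction k rule: inc_induct)
  case (step k)
  let ?p = "\<lambda>i j. a j (omit (Suc i) F j) + a j (omit (Suc i) F (Suc j))"
  let ?e = "\<lambda>j. a j (F (Suc j)) + a j (F (Suc (Suc j)))"
  have S: "{k..<n} = insert k {Suc k..<n}" "{k..n} = insert k {Suc k..n}"
    using step.hyps by auto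
  have 1: "(\<Sum>i\<in>{Suc k..n}. \<Prod>j\<in>{k..<n}. ?p i j)
    = (a k (F k) + a k (F (Suc k))) * (\<Prod>j\<in>{Suc k..<n}. ?e j)"
    unfolding step.IH [symmetric] sum_distrib_left S(1)
    by (rule sum.cong) (auto simp: omit_def)
  have 2: "(\<Prod>j\<in>{k..<n}. ?p k j) = (a k (F k) + a k (F (Suc (Suc k)))) * (\<Prod>j\<in>{Suc k..<n}. ?e j)"
    unfolding S(1) by (auto simp: omit_def intro!: prod.cong)
  have "(\<Sum>i\<in>{k..n}. \<Prod>j\<in>{k..<n}. ?p i j)
    = (\<Prod>j\<in>{k..<n}. ?p k j) + (\<Sum>i\<in>{Suc k..n}. \<Prod>j\<in>{k..<n}. ?p i j)"
    unfolding S(2) by simp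
  also have "\<dots> = (a k (F k) + a k (F (Suc (Suc k)))) * (\<Prod>j\<in>{Suc k..<n}. ?e j)
    + (a k (F k) + a k (F (Suc k))) * (\<Prod>j\<in>{Suc k..<n}. ?e j)"
    by (simp only: 1 2)
  also have "\<dots> = ?e k * (\<Prod>j\<in>{Suc k..<n}. ?e j)"
    unfolding distrib_right [symmetric] by (simp add: ac_simps)
  also have "\<dots> = (\<Prod>j\<in>{k..<n}. ?e j)"
    unfolding S(1) by simp
  finally show ?case .
next
  case base
  show ?case by simp
qed

text \<open>
  The cup product of the coboundaries of \<open>a\<^sub>0, \<dots>, a\<^sub>k\<^sub>-\<^sub>1\<close>, the 0-cochain \<open>t\<close> and the coboundaries of
  \<open>a\<^sub>k\<^sub>+\<^sub>1, \<dots>, a\<^sub>N\<^sub>-\<^sub>1\<close>, evaluated on a flag; \<open>sum_omit_cup\<close> is the Leibniz rule for it.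
\<close>

definition cup :: "nat \<Rightarrow> (nat \<Rightarrow> 'a \<Rightarrow> bit) \<Rightarrow> nat \<Rightarrow> ('a \<Rightarrow> bit) \<Rightarrow> (nat \<Rightarrow> 'a) \<Rightarrow> bit" where
  "cup N a k t G = (\<Prod>j<k. a j (G j) + a j (G (Suc j))) * t (G k)
    * (\<Prod>j\<in>{k..<N - 1}. a (Suc j) (G j) + a (Suc j) (G (Suc j)))"

lemma sum_omit_cup:
  fixes a :: "nat \<Rightarrow> 'a \<Rightarrow> bit"
  assumes k: "k < N"
  shows "(\<Sum>i\<le>N. cup N a k t (omit i F))
    = (\<Prod>j<k. a j (F j) + a j (F (Suc j))) * (t (F k) + t (F (Suc k)))
      * (\<Prod>j\<in>{Suc k..<N}. a j (F j) + a j (F (Suc j)))"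
proof -
  obtain n where n: "N = Suc n" using k by (cases N) auto
  have kn: "k \<le> n" using k n by simp
  let ?P = "\<Prod>j<k. a j (F j) + a j (F (Suc j))"
  let ?R = "\<Prod>j\<in>{k..<n}. a (Suc j) (F (Suc j)) + a (Suc j) (F (Suc (Suc j)))"
  \<comment> \<open>Omitting an index \<open>\<le> k\<close> moves the argument of \<open>t\<close>
    to \<open>F (Suc k)\<close>, omitting a later one leaves it at \<open>F k\<close>. The two
    groups of faces give the two terms of the coboundary of \<open>t\<close>.\<close>
  have 1: "(\<Sum>i\<le>k. cup N a k t (omit i F)) = ?P * t (F (Suc k)) * ?R"
  proof -
    have "cup N a k t (omit i F)
      = (\<Prod>j<k. a j (omit i F j) + a j (omit i F (Suc j))) * t (F (Suc k)) * ?R" if "i \<le> k" for i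
    proof -
      have "(\<Prod>j\<in>{k..<N - 1}. a (Suc j) (omit i F j) + a (Suc j) (omit i F (Suc j))) = ?R"
        by (rule prod.cong) (use that n in \<open>auto simp: omit_def\<close>)
      moreover have "omit i F k = F (Suc k)" using that by (simp add: omit_def)
      ultimately show ?thesis by (simp only: cup_def)
    qed
    then show ?thesis
      by (simp add: sum_distrib_right [symmetric] sum_omit_front)
  qed
  have 2: "(\<Sum>i\<in>{k..n}. cup N a k t (omit (Suc i) F)) = ?P * t (F k) * ?R"
  proof -
    have "cup N a k t (omit (Suc i) F)
      = ?P * t (F k) * (\<Prod>j\<in>{k..<n}. a (Suc j) (omit (Suc i) F j) + a (Suc j) (omit (Suc i) F (Suc j)))"
      if "k \<le> i" for i
    proof -
      have "(\<Prod>j<k. a j (omit (Suc i) F j) + a j (omit (Suc i) F (Suc j))) = ?P"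
        by (rule prod.cong) (use that in \<open>auto simp: omit_def\<close>)
      moreover have "omit (Suc i) F k = F k" using that by (simp add: omit_def)
      ultimately show ?thesis by (simp only: cup_def n diff_Suc_1)
    qed
    then show ?thesis
      by (simp add: sum_distrib_left [symmetric] sum_omit_back[OF kn, of "\<lambda>j. a (Suc j)"])
  qed
  have "{..N} = {..k} \<union> Suc ` {k..n}"
    using kn unfolding n image_Suc_atLeastAtMost by auto
  then have "(\<Sum>i\<le>N. cup N a k t (omit i F))
    = (\<Sum>i\<le>k. cup N a k t (omit i F)) + (\<Sum>i\<in>Suc ` {k..n}. cup N a k t (omit i F))"
    by (simp only:, subst sum.union_disjoint) auto
  also have "(\<Sum>i\<in>Suc ` {k..n}. cup N a k t (omit i F)) = (\<Sum>i\<in>{k..n}. cup N a k t (omit (Suc i) F))"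
    by (subst sum.reindex) auto
  also have "(\<Sum>i\<le>k. cup N a k t (omit i F)) + (\<Sum>i\<in>{k..n}. cup N a k t (omit (Suc i) F))
    = ?P * (t (F k) + t (F (Suc k))) * ?R"
    by (simp only: 1 2 distrib_left distrib_right add.commute)
  also have "?R = (\<Prod>j\<in>{Suc k..<N}. a j (F j) + a j (F (Suc j)))"
    unfolding n using prod.shift_bounds_Suc_ivl[of "\<lambda>j. a j (F j) + a j (F (Suc j))" k n] by simp
  finally show ?thesis .
qed

subsection \<open>Flags of cells in a grid\<close>

text \<open>
  The coordinates \<open>i < N\<close> of a cube are grouped into blocks \<open>b i\<close>, and \<open>e j r = 1\<close> says that the
  \<open>j\<close>-th function is odd in block \<open>r\<close>. The cube is \<open>[-M, M]\<^sup>N\<close>; in a cell, an even coordinate \<open>2 a\<close>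
  stands for the point \<open>a\<close> and an odd coordinate \<open>2 a + 1\<close> for the interval from \<open>a\<close> to \<open>a + 1\<close>.
\<close>

locale block_grid =
  fixes N :: nat and M :: int and b :: "nat \<Rightarrow> nat" and e :: "nat \<Rightarrow> nat \<Rightarrow> bit"
  assumes N_pos: "0 < N" and M_pos: "0 < M"
    and b_mono: "i \<le> j \<Longrightarrow> j < N \<Longrightarrow> b i \<le> b j"
    and e_own: "j < N \<Longrightarrow> e j (b j) = 1"
    and e_later: "j < N \<Longrightarrow> b j < r \<Longrightarrow> e j r = 0"
begin

definition cell :: "(nat \<Rightarrow> int) \<Rightarrow> bool" where
  "cell c \<longleftrightarrow> (\<forall>i<N. \<bar>c i\<bar> \<le> 2 * M) \<and> (\<forall>i\<ge>N. c i = 0)"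

definition on_bd :: "nat \<Rightarrow> (nat \<Rightarrow> int) \<Rightarrow> bool" where
  "on_bd r c \<longleftrightarrow> (\<exists>i<N. b i = r \<and> \<bar>c i\<bar> = 2 * M)"

definition flip :: "nat \<Rightarrow> (nat \<Rightarrow> int) \<Rightarrow> nat \<Rightarrow> int" where
  "flip r c i = (if b i = r then - c i else c i)"

text \<open>\<open>c\<close> is a facet of \<open>c'\<close>: one point coordinate of
  \<open>c\<close> is replaced by a unit interval next to that point.\<close>

definition step :: "(nat \<Rightarrow> int) \<Rightarrow> (nat \<Rightarrow> int) \<Rightarrow> bool" where
  "step c c' \<longleftrightarrow> (\<exists>i<N. even (c i) \<and> (\<exists>d. \<bar>d\<bar> = 1 \<and> c' = c(i := c i + d)))"

definition flags :: "(nat \<Rightarrow> nat \<Rightarrow> int) set" where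
  "flags = {F. (\<forall>j\<le>N. cell (F j)) \<and> (\<forall>j>N. F j = (\<lambda>_. 0)) \<and> (\<forall>i. even (F 0 i))
    \<and> (\<forall>j<N. step (F j) (F (Suc j)))}"

lemma finite_cells: "finite {c. cell c}"
proof (rule finite_subset)
  show "{c. cell c} \<subseteq> {c. \<forall>i. (i \<in> {..<N} \<longrightarrow> c i \<in> {-2*M..2*M}) \<and> (i \<notin> {..<N} \<longrightarrow> c i = 0)}"
    by (auto simp: cell_def abs_le_iff)
qed (rule finite_set_of_finite_funs; simp)

lemma finite_flags: "finite flags"
proof (rule finite_subset)
  show "flags \<subseteq> {F. \<forall>j. (j \<in> {..N} \<longrightarrow> F j \<in> {c. cell c}) \<and> (j \<notin> {..N} \<longrightarrow> F j = (\<lambda>_. 0))}"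
    by (auto simp: flags_def)
qed (rule finite_set_of_finite_funs; simp add: finite_cells)

lemma flagsD:
  assumes "F \<in> flags"
  shows "j \<le> N \<Longrightarrow> cell (F j)" "N < j \<Longrightarrow> F j = (\<lambda>_. 0)" "even (F 0 i)"
    "j < N \<Longrightarrow> step (F j) (F (Suc j))"
  using assms by (auto simp: flags_def)

lemma stepE:
  assumes "step c c'"
  obtains i d where "i < N" "even (c i)" "\<bar>d\<bar> = 1" "c' = c(i := c i + d)"
  using assms by (auto simp: step_def)

lemma stepI: "i < N \<Longrightarrow> even (c i) \<Longrightarrow> \<bar>d\<bar> = 1 \<Longrightarrow> step c (c(i := c i + d))"
  by (auto simp: step_def)

lemma step_even: "step c c' \<Longrightarrow> even (c' i) \<Longrightarrow> c i = c' i"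
  by (erule stepE) (auto split: if_splits)

lemma step_odd: "step c c' \<Longrightarrow> odd (c i) \<Longrightarrow> c' i = c i"
  by (erule stepE) auto

text \<open>A coordinate moves at most once along a flag, and then from even to odd. As long as it
  is even, it still has its initial value.\<close>

lemma flag_even:
  assumes F: "F \<in> flags" and "j \<le> j'" "j' \<le> N" "even (F j' i)"
  shows "F j i = F j' i"
  using assms(2-4)
proof (induction j' rule: dec_induct)
  case (step n)
  then show ?case using step_even[OF flagsD(4)[OF F, of n]] by auto
qed simp

lemma flag_odd:
  assumes F: "F \<in> flags" and "j \<le> j'" "j' \<le> N" "odd (F j i)"
  shows "F j' i = F j i"
  using assms(2-4)
proof (induction j' rule: dec_induct)
  case (step n)
  then show ?case using step_odd[OF flagsD(4)[OF F, of n]] by auto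
qed simp

lemma cell_flip [simp]: "cell (flip r c) \<longleftrightarrow> cell c"
  by (auto simp: cell_def flip_def)

lemma flip_flip [simp]: "flip r (flip r c) = c"
  by (auto simp: flip_def)

lemma even_flip [simp]: "even (flip r c i) \<longleftrightarrow> even (c i)"
  by (simp add: flip_def)

lemma on_bd_flip [simp]: "on_bd r (flip r' c) \<longleftrightarrow> on_bd r c"
  unfolding on_bd_def by (intro arg_cong[where f=Ex] ext) (auto simp: flip_def)

lemma step_flip:
  assumes "step c c'"
  shows "step (flip r c) (flip r c')"
proof -
  obtain i d where *: "i < N" "even (c i)" "\<bar>d\<bar> = 1" "c' = c(i := c i + d)"
    using assms by (rule stepE)
  have "flip r c' = (flip r c)(i := flip r c i + (if b i = r then - d else d))"
    using *(4) by (auto simp: flip_def)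
  then show ?thesis using stepI[of i "flip r c" "if b i = r then - d else d"] * by auto
qed

lemma flip_flags:
  assumes "F \<in> flags"
  shows "(\<lambda>j. flip r (F j)) \<in> flags"
  using assms unfolding flags_def by (auto intro: step_flip simp: flip_def)

lemma flags_update:
  assumes F: "F \<in> flags" and i: "i \<le> N" and c: "cell c"
    and "i = 0 \<Longrightarrow> \<forall>x. even (c x)"
    and "0 < i \<Longrightarrow> step (F (i - 1)) c"
    and "i < N \<Longrightarrow> step c (F (Suc i))"
  shows "F(i := c) \<in> flags"
  using assms unfolding flags_def by (auto simp: less_Suc_eq_0_disj)

lemma omit_update [simp]: "omit i (F(i := c)) = omit i F"
  by (auto simp: omit_def)

lemma cell_update:
  assumes "cell c" "x < N" "\<bar>v\<bar> \<le> 2 * M"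
  shows "cell (c(x := v))"
  using assms by (auto simp: cell_def)

lemma cell_bound: "cell c \<Longrightarrow> i < N \<Longrightarrow> \<bar>c i\<bar> \<le> 2 * M"
  by (simp add: cell_def)

text \<open>
  Removing one member of a maximal flag leaves a chain that has exactly one other completion. Only if
  the top member is removed from a flag at the boundary, there is none; then the flag is paired
  with its antipode in the block concerned.
\<close>

lemma sum_flags_omit_0: "(\<Sum>F\<in>flags. \<phi> (omit 0 F) :: bit) = 0"
proof (rule sum_bit_involution[OF finite_flags])
  let ?\<psi> = "\<lambda>F. F(0 := \<lambda>i. 2 * F (Suc 0) i - F 0 i)"
  fix F assume F: "F \<in> flags"
  obtain x d where x: "x < N" "even (F 0 x)" "\<bar>d\<bar> = 1" "F (Suc 0) = (F 0)(x := F 0 x + d)"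
    using flagsD(4)[OF F N_pos] by (rule stepE)
  let ?c = "(F 0)(x := F 0 x + 2 * d)"
  have eq: "(\<lambda>i. 2 * F (Suc 0) i - F 0 i) = ?c" using x(4) by auto
  have "\<bar>F (Suc 0) x\<bar> \<le> 2 * M" using cell_bound flagsD(1)[OF F, of 1] N_pos x(1) by simp
  then have "\<bar>F 0 x + 2 * d\<bar> \<le> 2 * M" using x(2-4) by simp presburger
  then have "cell ?c" using flagsD(1)[OF F, of 0] x(1) by (simp add: cell_update)
  moreover have "step ?c (F (Suc 0))"
    using stepI[of x ?c "- d"] x by (simp add: add.commute)
  ultimately have "?\<psi> F \<in> flags"
    unfolding eq using flagsD(3)[OF F] by (intro flags_update F) auto
  moreover have "?\<psi> F \<noteq> F"
  proof -
    have "?\<psi> F 0 x \<noteq> F 0 x" unfolding eq using x(3) by auto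
    then show ?thesis by metis
  qed
  ultimately show "?\<psi> F \<in> flags \<and> ?\<psi> (?\<psi> F) = F \<and> ?\<psi> F \<noteq> F \<and> \<phi> (omit 0 (?\<psi> F)) = \<phi> (omit 0 F)"
    by auto
qed

lemma sum_flags_omit_middle:
  assumes i: "0 < i" "i < N"
  shows "(\<Sum>F\<in>flags. \<phi> (omit i F) :: bit) = 0"
proof (rule sum_bit_involution[OF finite_flags])
  \<comment> \<open>Two coordinates become odd between \<open>F (i - 1)\<close> and
    \<open>F (Suc i)\<close>; the other completion moves them in the opposite order.\<close>
  let ?\<psi> = "\<lambda>F. F(i := \<lambda>x. F (i - 1) x + F (Suc i) x - F i x)"
  fix F assume F: "F \<in> flags"
  have "step (F (i - 1)) (F i)" using flagsD(4)[OF F, of "i - 1"] i by simp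
  then obtain x d where x: "x < N" "even (F (i - 1) x)" "\<bar>d\<bar> = 1" "F i = (F (i - 1))(x := F (i - 1) x + d)"
    by (rule stepE)
  obtain y d' where y: "y < N" "even (F i y)" "\<bar>d'\<bar> = 1" "F (Suc i) = (F i)(y := F i y + d')"
    using flagsD(4)[OF F i(2)] by (rule stepE)
  have "odd d" using x(3) by presburger
  then have xy: "x \<noteq> y" using x y by auto
  let ?c = "(F (i - 1))(y := F (i - 1) y + d')"
  have eq: "(\<lambda>x. F (i - 1) x + F (Suc i) x - F i x) = ?c" using x(4) y(4) xy by auto
  have "\<bar>F (Suc i) y\<bar> \<le> 2 * M" using cell_bound flagsD(1)[OF F, of "Suc i"] i y(1) by simp
  then have "\<bar>F (i - 1) y + d'\<bar> \<le> 2 * M" using x(4) y(4) xy by simp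
  then have "cell ?c" using flagsD(1)[OF F, of "i - 1"] i y(1) by (simp add: cell_update)
  moreover have "step (F (i - 1)) ?c"
    using stepI[of y "F (i - 1)" d'] x y xy by simp
  moreover have "step ?c (F (Suc i))"
  proof -
    have "F (Suc i) = ?c(x := ?c x + d)" unfolding y(4) x(4) using xy by auto
    then show ?thesis using stepI[of x ?c d] x xy by simp
  qed
  ultimately have "?\<psi> F \<in> flags"
    unfolding eq using i by (intro flags_update F) auto
  moreover have "?\<psi> F \<noteq> F"
  proof -
    have "?\<psi> F i y \<noteq> F i y" unfolding eq using x(4) y(3) xy by auto
    then show ?thesis by metis
  qed
  moreover have "?\<psi> (?\<psi> F) = F" using i by auto
  ultimately show "?\<psi> F \<in> flags \<and> ?\<psi> (?\<psi> F) = F \<and> ?\<psi> F \<noteq> F \<and> \<phi> (omit i (?\<psi> F)) = \<phi> (omit i F)"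
    by auto
qed

lemma sum_flags_omit_top:
  assumes inv: "\<And>r G. (\<And>j. j < N \<Longrightarrow> cell (G j) \<and> on_bd r (G j)) \<Longrightarrow> \<phi> (\<lambda>j. flip r (G j)) = \<phi> G"
  shows "(\<Sum>F\<in>flags. \<phi> (omit N F) :: bit) = 0"
proof (rule sum_bit_involution[OF finite_flags])
  define n where "n = N - 1"
  have N: "N = Suc n" using N_pos by (simp add: n_def)
  define c where "c F = (\<lambda>x. 2 * F n x - F N x)" for F :: "nat \<Rightarrow> nat \<Rightarrow> int"
  \<comment> \<open>The block of the coordinate moved last. That coordinate is unique, and the
    flipped flag yields the same block, which makes \<open>?\<psi>\<close> an involution.\<close>
  define r where "r F = b (SOME x. F N x \<noteq> F n x)" for F :: "nat \<Rightarrow> nat \<Rightarrow> int"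
  let ?\<psi> = "\<lambda>F. if cell (c F) then F(N := c F) else (\<lambda>j. flip (r F) (F j))"
  fix F assume F: "F \<in> flags"
  have "step (F n) (F N)" using flagsD(4)[OF F, of n] by (metis N lessI)
  then obtain x d where x: "x < N" "even (F n x)" "\<bar>d\<bar> = 1" "F N = (F n)(x := F n x + d)"
    by (rule stepE)
  have ne: "F N y \<noteq> F n y \<longleftrightarrow> y = x" for y using x by auto
  have r: "r F = b x" unfolding r_def ne by simp
  have c: "c F = (F n)(x := F n x - d)" unfolding c_def x(4) by auto
  show "?\<psi> F \<in> flags \<and> ?\<psi> (?\<psi> F) = F \<and> ?\<psi> F \<noteq> F \<and> \<phi> (omit N (?\<psi> F)) = \<phi> (omit N F)"
  proof (cases "cell (c F)")
    case True
    have "step (F n) (c F)" unfolding c using stepI[of x "F n" "- d"] x by simp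
    then have "F(N := c F) \<in> flags" using True N by (intro flags_update F) auto
    moreover have "c (F(N := c F)) = F N" by (auto simp: c_def N)
    moreover have "cell (F N)" using flagsD(1)[OF F] by simp
    moreover have "F(N := c F) \<noteq> F"
    proof -
      have "c F x \<noteq> F N x" unfolding c x(4) using x(3) by auto
      then show ?thesis by (metis fun_upd_same)
    qed
    ultimately show ?thesis using True by simp
  next
    case False
    have "cell (F n)" using flagsD(1)[OF F] N by simp
    have "\<bar>F n x\<bar> = 2 * M"
    proof -
      have "\<not> \<bar>F n x - d\<bar> \<le> 2 * M"
        using False cell_update[OF \<open>cell (F n)\<close> x(1)] unfolding c by blast
      moreover obtain v where "F n x = 2 * v" using x(2) by (rule evenE)
      ultimately show ?thesis using cell_bound[OF \<open>cell (F n)\<close> x(1)] x(3) by linarith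
    qed
    let ?G = "\<lambda>j. flip (r F) (F j)"
    have "c ?G = flip (r F) (c F)" by (auto simp: c_def flip_def)
    moreover have "r ?G = r F"
    proof -
      have "?G N y \<noteq> ?G n y \<longleftrightarrow> y = x" for y using ne[of y] by (auto simp: flip_def)
      then show ?thesis unfolding r unfolding r_def by simp
    qed
    moreover have "?G \<in> flags" by (rule flip_flags[OF F])
    moreover have "?G \<noteq> F"
    proof -
      have "?G n x \<noteq> F n x" using \<open>\<bar>F n x\<bar> = 2 * M\<close> M_pos r by (auto simp: flip_def)
      then show ?thesis by metis
    qed
    moreover have "\<phi> (omit N ?G) = \<phi> (omit N F)"
    proof -
      have "omit N ?G = (\<lambda>j. flip (r F) (omit N F j))" by (auto simp: omit_def)
      moreover have "cell (omit N F j) \<and> on_bd (r F) (omit N F j)" if "j < N" for j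
      proof -
        \<comment> \<open>As \<open>x\<close> is moved last, all members but the top one agree at
          \<open>x\<close> and lie on the boundary of the same block, where \<open>inv\<close>
          applies.\<close>
        have "F j x = F n x" using flag_even[OF F, of j n x] that N x(2) by simp
        then have "on_bd (r F) (F j)"
          unfolding on_bd_def r using x(1) \<open>\<bar>F n x\<bar> = 2 * M\<close> by auto
        then show ?thesis using that flagsD(1)[OF F, of j] by (simp add: omit_def)
      qed
      ultimately show ?thesis using inv[of "omit N F" "r F"] by simp
    qed
    ultimately show ?thesis using False by simp
  qed
qed

section \<open>Equivariant cochains and the invariance of \<open>Phi\<close>\<close>

text \<open>Bits stand for signs, so adding \<open>\<epsilon> r\<close> changes the sign iff the
  parity in block \<open>r\<close> is odd. Only boundary cells are constrained because only these
  are identified with their antipodes.\<close>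

definition equivariant :: "(nat \<Rightarrow> bit) \<Rightarrow> ((nat \<Rightarrow> int) \<Rightarrow> bit) \<Rightarrow> bool" where
  "equivariant \<epsilon> s \<longleftrightarrow> (\<forall>r c. cell c \<longrightarrow> on_bd r c \<longrightarrow> s (flip r c) = s c + \<epsilon> r)"

definition Phi :: "(nat \<Rightarrow> (nat \<Rightarrow> int) \<Rightarrow> bit) \<Rightarrow> bit" where
  "Phi s = (\<Sum>F\<in>flags. \<Prod>j<N. s j (F j) + s j (F (Suc j)))"

text \<open>Since \<open>s k\<close> and \<open>t\<close> have the same parities, their difference
  \<open>u\<close> is invariant under flips on the boundary. So \<open>Phi\<close> changes by a
  coboundary, evaluated on a chain that is closed modulo the antipodal identification.\<close>

lemma Phi_update:
  assumes s: "\<And>j. j < N \<Longrightarrow> equivariant (e j) (s j)" and k: "k < N" and t: "equivariant (e k) t"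
  shows "Phi (s(k := t)) = Phi s"
proof -
  define u where "u c = s k c + t c" for c
  let ?f = "\<lambda>F j. s j (F j) + s j (F (Suc j))"
  have u: "u (flip r c) = u c" if "cell c" "on_bd r c" for r c
    using that s[OF k] t unfolding equivariant_def u_def by (simp add: ac_simps)
  have s_diff: "s j (flip r c) + s j (flip r c') = s j c + s j c'"
    if "j < N" "cell c" "cell c'" "on_bd r c" "on_bd r c'" for j r c c'
    using that s[of j] unfolding equivariant_def by (simp add: ac_simps)
  have inv: "cup N s k u (\<lambda>j. flip r (G j)) = cup N s k u G"
    if G: "\<And>j. j < N \<Longrightarrow> cell (G j) \<and> on_bd r (G j)" for r G
    unfolding cup_def using G k
    by (intro arg_cong2[where f="(*)"] prod.cong) (auto simp: u intro!: s_diff)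
  have split: "(\<Prod>j<N. f j) = (\<Prod>j<k. f j) * f k * (\<Prod>j\<in>{Suc k..<N}. f j)" for f :: "nat \<Rightarrow> bit"
  proof -
    have "(\<Prod>j<N. f j) = (\<Prod>j\<in>{..<Suc k} \<union> {Suc k..<N}. f j)"
      using k by (intro prod.cong) auto
    also have "\<dots> = (\<Prod>j<Suc k. f j) * (\<Prod>j\<in>{Suc k..<N}. f j)"
      by (rule prod.union_disjoint) auto
    finally show ?thesis by (simp only: prod.lessThan_Suc)
  qed
  have "Phi (s(k := t)) + Phi s = (\<Sum>F\<in>flags. (\<Prod>j<k. ?f F j) * (u (F k) + u (F (Suc k))) * (\<Prod>j\<in>{Suc k..<N}. ?f F j))"
    unfolding Phi_def sum.distrib [symmetric] split
    by (intro sum.cong) (auto simp: u_def algebra_simps)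
  also have "\<dots> = (\<Sum>F\<in>flags. \<Sum>i\<le>N. cup N s k u (omit i F))"
    unfolding sum_omit_cup[OF k] ..
  also have "\<dots> = (\<Sum>i\<le>N. \<Sum>F\<in>flags. cup N s k u (omit i F))"
    by (rule sum.swap)
  also have "\<dots> = 0"
  proof (rule sum.neutral, rule ballI)
    fix i assume "i \<in> {..N}"
    then consider "i = 0" | "0 < i" "i < N" | "i = N" by force
    then show "(\<Sum>F\<in>flags. cup N s k u (omit i F)) = 0"
      by cases (auto intro: sum_flags_omit_0 sum_flags_omit_middle sum_flags_omit_top inv)
  qed
  finally show ?thesis by simp
qed

lemma Phi_eq:
  assumes s: "\<And>j. j < N \<Longrightarrow> equivariant (e j) (s j)" and t: "\<And>j. j < N \<Longrightarrow> equivariant (e j) (t j)"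
  shows "Phi s = Phi t"
proof -
  have "Phi (\<lambda>j. if j < n then t j else s j) = Phi s" if "n \<le> N" for n
    using that
  proof (induction n)
    case (Suc n)
    let ?h = "\<lambda>n j. if j < n then t j else s j"
    have "?h (Suc n) = (?h n)(n := t n)" by auto
    then have "Phi (?h (Suc n)) = Phi (?h n)"
      using Suc.prems s t by (simp only:) (rule Phi_update, auto)
    then show ?case using Suc by simp
  qed simp
  from this[of N] have "Phi s = Phi (\<lambda>j. if j < N then t j else s j)" by simp
  also have "\<dots> = Phi t" unfolding Phi_def by (intro sum.cong prod.cong) auto
  finally show ?thesis .
qed

subsection \<open>A system with exactly one solution\<close>

definition lo :: "nat \<Rightarrow> nat" where "lo j = (LEAST i. b i = b j)"
definition hi :: "nat \<Rightarrow> nat" where "hi j = Max {i. i < N \<and> b i = b j}"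

lemma lo_le: "lo j \<le> j" and b_lo: "b (lo j) = b j"
  unfolding lo_def by (auto intro: Least_le LeastI)

lemma hi_props:
  assumes "j < N"
  shows "hi j < N" "b (hi j) = b j" "\<And>i. i < N \<Longrightarrow> b i = b j \<Longrightarrow> i \<le> hi j"
proof -
  have "hi j \<in> {i. i < N \<and> b i = b j}"
    unfolding hi_def by (rule Max_in) (use assms in auto)
  then show "hi j < N" "b (hi j) = b j" by auto
  show "i \<le> hi j" if "i < N" "b i = b j" for i
    unfolding hi_def by (rule Max_ge) (use that in auto)
qed

lemma block_iff: "i < N \<Longrightarrow> j < N \<Longrightarrow> b i = b j \<longleftrightarrow> lo j \<le> i \<and> i \<le> hi j"
proof
  assume "i < N" "j < N" "b i = b j"
  then show "lo j \<le> i \<and> i \<le> hi j"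
    using hi_props(3) unfolding lo_def by (auto intro: Least_le)
next
  assume "i < N" "j < N" "lo j \<le> i \<and> i \<le> hi j"
  then show "b i = b j"
    using b_mono[of "lo j" i] b_mono[of i "hi j"] b_lo[of j] hi_props[of j] by auto
qed

lemma Suc_block:
  assumes j: "j < N" and "j \<noteq> hi j"
  shows "Suc j < N" "b (Suc j) = b j" "j < hi j"
proof -
  show *: "j < hi j" using assms hi_props(3)[OF j, of j] by simp
  then show **: "Suc j < N" using hi_props(1)[OF j] by simp
  show "b (Suc j) = b j" using * ** block_iff[of "Suc j" j] lo_le[of j] j by simp
qed

lemma block_cong: "b i = b j \<Longrightarrow> lo i = lo j \<and> hi i = hi j"
  by (simp add: lo_def hi_def)

text \<open>Selects one cell of each antipodal pair on the boundary of block \<open>r\<close>, by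
  the sign of the last nonzero coordinate; these cells form the upper hemispheres of nested
  equators.\<close>

definition hemi :: "nat \<Rightarrow> (nat \<Rightarrow> int) \<Rightarrow> bit" where
  "hemi r c = of_bool (on_bd r c \<and> 0 < c (Max {i. i < N \<and> b i = r \<and> c i \<noteq> 0}))"

lemma hemi_eq:
  assumes "on_bd r c" "i < N" "b i = r" "c i \<noteq> 0"
    and "\<And>i'. i < i' \<Longrightarrow> i' < N \<Longrightarrow> b i' = r \<Longrightarrow> c i' = 0"
  shows "hemi r c = of_bool (0 < c i)"
proof -
  have "Max {i. i < N \<and> b i = r \<and> c i \<noteq> 0} = i"
    using assms by (intro Max_eqI) (auto simp: not_less [symmetric])
  then show ?thesis using assms(1) by (simp add: hemi_def)
qed

lemma hemi_interior: "\<not> on_bd r c \<Longrightarrow> hemi r c = 0"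
  by (simp add: hemi_def)

lemma hemi_cong:
  assumes "\<And>i. i < N \<Longrightarrow> b i = r \<Longrightarrow> c i = c' i"
  shows "hemi r c = hemi r c'"
proof (cases "on_bd r c")
  case True
  have S: "{i. i < N \<and> b i = r \<and> c i \<noteq> 0} = {i. i < N \<and> b i = r \<and> c' i \<noteq> 0}" (is "?A = _")
    using assms by auto
  have "?A \<noteq> {}" using True M_pos by (auto simp: on_bd_def)
  then have "Max ?A \<in> ?A" by (intro Max_in) auto
  then have "c (Max ?A) = c' (Max ?A)" using assms by blast
  moreover have "on_bd r c'" using True assms by (auto simp: on_bd_def)
  ultimately show ?thesis using True unfolding hemi_def S by simp
next
  case False
  then have "\<not> on_bd r c'" using assms by (auto simp: on_bd_def)
  then show ?thesis using False by (simp add: hemi_interior)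
qed

lemma hemi_flip_same:
  assumes "on_bd r c"
  shows "hemi r (flip r c) = hemi r c + 1"
proof -
  let ?A = "{i. i < N \<and> b i = r \<and> c i \<noteq> 0}"
  have A: "{i. i < N \<and> b i = r \<and> flip r c i \<noteq> 0} = ?A" by (auto simp: flip_def)
  have "?A \<noteq> {}" using assms M_pos by (auto simp: on_bd_def)
  then have "Max ?A \<in> ?A" by (intro Max_in) auto
  then show ?thesis using assms unfolding hemi_def A by (auto simp: flip_def)
qed

lemma hemi_flip_other: "r \<noteq> r' \<Longrightarrow> hemi r (flip r' c) = hemi r c"
  by (rule hemi_cong) (auto simp: flip_def)

text \<open>
  Combinations of the hemisphere functions \<open>hemi r\<close>, prescribed by the parities. As \<open>hemi r\<close> vanishes in
  the interior of block \<open>r\<close>, the mixed terms for earlier blocks do not contribute to \<open>Phi\<close>.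
\<close>

definition base :: "nat \<Rightarrow> (nat \<Rightarrow> int) \<Rightarrow> bit" where
  "base j c = hemi (b j) c + (\<Sum>r<b j. e j r * hemi r c)"

lemma equivariant_base:
  assumes j: "j < N"
  shows "equivariant (e j) (base j)"
  unfolding equivariant_def
proof (intro allI impI)
  fix r c assume bd: "on_bd r c"
  consider "r < b j" | "r = b j" | "b j < r" by linarith
  then show "base j (flip r c) = base j c + e j r"
  proof cases
    case 1
    then have "{..<b j} = insert r ({..<b j} - {r})" by auto
    then have split: "(\<Sum>x<b j. f x) = f r + (\<Sum>x\<in>{..<b j} - {r}. f x)" for f :: "nat \<Rightarrow> bit"
      using 1 by (metis finite_lessThan lessThan_iff sum.remove)
    have "(\<Sum>x\<in>{..<b j} - {r}. e j x * hemi x (flip r c)) = (\<Sum>x\<in>{..<b j} - {r}. e j x * hemi x c)"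
      by (rule sum.cong) (auto simp: hemi_flip_other)
    then show ?thesis
      unfolding base_def split using 1 bd
      by (simp add: hemi_flip_same hemi_flip_other algebra_simps)
  next
    case 2
    have "(\<Sum>x<b j. e j x * hemi x (flip r c)) = (\<Sum>x<b j. e j x * hemi x c)"
      by (rule sum.cong) (auto simp: hemi_flip_other 2)
    then show ?thesis
      unfolding base_def using 2 bd e_own[OF j] by (simp add: hemi_flip_same ac_simps)
  next
    case 3
    have "(\<Sum>x<b j. e j x * hemi x (flip r c)) = (\<Sum>x<b j. e j x * hemi x c)"
      by (rule sum.cong) (use 3 in \<open>auto simp: hemi_flip_other\<close>)
    then show ?thesis
      unfolding base_def using 3 e_later[OF j, of r] by (simp add: hemi_flip_other)
  qed
qed

text \<open>The signs are forced backwards from the end of the block: the last step must take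
  \<open>hemi\<close> from 1 to the interior value 0, and every earlier step must change it.\<close>

definition sgn_at :: "nat \<Rightarrow> int" where
  "sgn_at i = (if odd (Suc (hi i) - i) then 1 else -1)"

text \<open>
  The only flag that contributes to \<open>Phi base\<close>. In each block it starts at the boundary point
  \<open>(\<plusminus>M, 0, \<dots>, 0)\<close>, leaves the equators one by one with alternating signs, and enters the
  interior in the last step.
\<close>

definition base_flag :: "nat \<Rightarrow> nat \<Rightarrow> int" where
  "base_flag j i = (if N < j \<or> N \<le> i then 0
    else sgn_at i * (if lo i = i then (if j \<le> hi i then 2 * M else 2 * M - 1) else of_bool (i \<le> j)))"

lemma sgn_at_abs [simp]: "\<bar>sgn_at i\<bar> = 1"
  by (simp add: sgn_at_def)

lemma base_flag_flags: "base_flag \<in> flags"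
  unfolding flags_def mem_Collect_eq
proof (intro conjI allI impI)
  show "cell (base_flag j)" for j
    using M_pos by (auto simp: cell_def base_flag_def abs_mult)
  show "base_flag j = (\<lambda>_. 0)" if "N < j" for j
    using that by (auto simp: base_flag_def)
  show "even (base_flag 0 i)" for i
    by (cases "i = 0") (auto simp: base_flag_def lo_def)
  fix j assume j: "j < N"
  \<comment> \<open>Step \<open>j\<close> moves coordinate \<open>Suc j\<close>, except that the
    last step of a block moves the first coordinate of the block off the boundary.\<close>
  show "step (base_flag j) (base_flag (Suc j))"
  proof (cases "j = hi j")
    case True
    let ?p = "lo j"
    have p: "?p < N" "b ?p = b j" "lo ?p = ?p" "hi ?p = j"
      using lo_le[of j] b_lo[of j] j True block_cong[of "lo j" j] by auto
    have "base_flag (Suc j) i = base_flag j i" if "i \<noteq> ?p" for i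
    proof -
      have "j \<noteq> hi i" if "lo i = i" "i < N"
        using that \<open>i \<noteq> ?p\<close> hi_props(2)[of i] block_cong[of j i] by auto
      moreover have "i \<noteq> Suc j" if "lo i \<noteq> i" "i < N"
      proof
        assume "i = Suc j"
        then have "lo i \<le> j" using that lo_le[of i] by simp
        then have "b j = b i" using block_iff[of j i] j that \<open>i = Suc j\<close> hi_props(3)[of i i] by auto
        then show False using hi_props(3)[OF j, of i] that True \<open>i = Suc j\<close> by simp
      qed
      ultimately show ?thesis using j by (auto simp: base_flag_def)
    qed
    then have "base_flag (Suc j) = (base_flag j)(?p := base_flag j ?p + (- sgn_at ?p))"
      using p j by (auto simp: base_flag_def algebra_simps)
    moreover have "even (base_flag j ?p)" using p j by (simp add: base_flag_def)
    ultimately show ?thesis using stepI[of ?p "base_flag j" "- sgn_at ?p"] p by simp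
  next
    case False
    let ?p = "Suc j"
    have p: "?p < N" "b ?p = b j" using Suc_block[OF j False] by auto
    then have lo: "lo ?p \<noteq> ?p" using block_cong[of "Suc j" j] lo_le[of j] by simp
    have "base_flag (Suc j) i = base_flag j i" if "i \<noteq> ?p" for i
    proof -
      have "j \<noteq> hi i" if "lo i = i" "i < N"
        using that hi_props(2)[of i] block_cong[of j i] False by auto
      then show ?thesis using that j by (auto simp: base_flag_def)
    qed
    then have "base_flag (Suc j) = (base_flag j)(?p := base_flag j ?p + sgn_at ?p)"
      using p j lo by (auto simp: base_flag_def)
    moreover have "even (base_flag j ?p)" using p lo by (simp add: base_flag_def)
    ultimately show ?thesis using stepI[of ?p "base_flag j" "sgn_at ?p"] p by simp
  qed
qed

lemma base_flag_hemi_past: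
  assumes "\<And>i. i < N \<Longrightarrow> b i = r \<Longrightarrow> i < j"
  shows "hemi r (base_flag j) = 0"
proof (rule hemi_interior)
  show "\<not> on_bd r (base_flag j)"
  proof
    assume "on_bd r (base_flag j)"
    then obtain i where i: "i < N" "b i = r" "\<bar>base_flag j i\<bar> = 2 * M"
      by (auto simp: on_bd_def)
    then have "hi i < j" using assms hi_props[OF i(1)] by auto
    then show False
      using i M_pos by (auto simp: base_flag_def abs_mult of_bool_def split: if_splits) presburger
  qed
qed

lemma base_flag_hemi:
  assumes j: "j < N"
  shows "hemi (b j) (base_flag j) = of_bool (odd (Suc (hi j) - j))"
proof -
  let ?p = "lo j"
  have p: "?p < N" "b ?p = b j" "lo ?p = ?p" "hi ?p = hi j"
    using lo_le[of j] b_lo[of j] j block_cong[of "lo j" j] by auto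
  have "on_bd (b j) (base_flag j)"
    unfolding on_bd_def
    by (rule exI[of _ ?p]) (use p j hi_props(3)[OF j, of j] M_pos in \<open>auto simp: base_flag_def abs_mult\<close>)
  moreover have "base_flag j j \<noteq> 0" and pos: "0 < base_flag j j \<longleftrightarrow> odd (Suc (hi j) - j)"
    using j M_pos by (auto simp: base_flag_def sgn_at_def)
  moreover have "base_flag j i = 0" if "j < i" "i < N" "b i = b j" for i
  proof -
    have "lo i = lo j" using that block_cong by blast
    then have "lo i \<noteq> i" using that lo_le[of j] by simp
    then show ?thesis using that by (simp add: base_flag_def)
  qed
  ultimately show ?thesis using hemi_eq[of "b j" "base_flag j" j] j by simp
qed

lemma base_flag_base:
  assumes j: "j < N"
  shows "base j (base_flag j) \<noteq> base j (base_flag (Suc j))"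
proof -
  have "hemi r (base_flag i) = 0" if "r < b j" "j \<le> i" for r i
  proof (rule base_flag_hemi_past)
    show "i' < i" if "i' < N" "b i' = r" for i'
      using that \<open>r < b j\<close> \<open>j \<le> i\<close> b_mono[of j i'] by (cases "i' < j") auto
  qed
  then have eq: "base j (base_flag i) = hemi (b j) (base_flag i)" if "j \<le> i" for i
    using that unfolding base_def by (auto intro: sum.neutral)
  have "hemi (b j) (base_flag (Suc j)) = of_bool (even (Suc (hi j) - j))"
  proof (cases "j = hi j")
    case True
    then show ?thesis
      using base_flag_hemi_past[of "b j" "Suc j"] hi_props[OF j] by (auto simp: less_Suc_eq_le)
  next
    case False
    then have p: "Suc j < N" "b (Suc j) = b j" "j < hi j"
      using Suc_block[OF j False] by auto
    then have "hi (Suc j) = hi j" using block_cong by blast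
    then show ?thesis using base_flag_hemi[OF p(1)] p by (auto simp: Suc_diff_le)
  qed
  then show ?thesis using base_flag_hemi[OF j] by (simp add: eq)
qed

text \<open>In a contributing flag, step \<open>j\<close> moves a coordinate of block
  \<open>b j\<close>. Within a block the values of \<open>hemi\<close> alternate and are known at
  the end, which forces the coordinates and their signs.\<close>

lemma flag_unique:
  assumes F: "F \<in> flags" and ne: "\<And>j. j < N \<Longrightarrow> base j (F j) \<noteq> base j (F (Suc j))"
  shows "F = base_flag"
proof -
  have "\<exists>x d. x < N \<and> even (F j x) \<and> \<bar>d\<bar> = 1 \<and> F (Suc j) = (F j)(x := F j x + d)" if "j < N" for j
    using flagsD(4)[OF F that] by (auto simp: step_def)
  then obtain x d where x: "\<And>j. j < N \<Longrightarrow> x j < N" "\<And>j. j < N \<Longrightarrow> even (F j (x j))"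
    and d: "\<And>j. j < N \<Longrightarrow> \<bar>d j :: int\<bar> = 1"
    and Fx: "\<And>j. j < N \<Longrightarrow> F (Suc j) = (F j)(x j := F j (x j) + d j)"
    by metis
  have odd_after: "odd (F j (x i))" if "i < j" "j \<le> N" for i j
  proof -
    have "odd (d i)" using d[of i] that by presburger
    then have "odd (F (Suc i) (x i))" using Fx[of i] x(2)[of i] that by simp
    then show ?thesis using flag_odd[OF F, of "Suc i" j] that by simp
  qed
  \<comment> \<open>No coordinate moves twice, so the \<open>N\<close> steps permute the
    coordinates.\<close>
  have inj: "inj_on x {..<N}"
  proof (rule linorder_inj_onI)
    show "x i \<noteq> x j" if "i < j" "i \<in> {..<N}" "j \<in> {..<N}" for i j
      using odd_after[of i j] x(2)[of j] that by auto
  qed auto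
  \<comment> \<open>\<open>base j\<close> depends only on blocks up to \<open>b j\<close>, so step
    \<open>j\<close> moves a coordinate there. It cannot belong to an earlier block: by induction
    the steps of that block have already moved all of its coordinates.\<close>
  have bx: "b (x j) = b j" if "j < N" for j
    using that
  proof (induction j rule: less_induct)
    case (less j)
    have "\<exists>r\<le>b j. hemi r (F j) \<noteq> hemi r (F (Suc j))"
    proof (rule ccontr)
      assume "\<not> ?thesis"
      then have "base j (F j) = base j (F (Suc j))" by (simp add: base_def)
      then show False using ne less.prems by blast
    qed
    then obtain r where r: "r \<le> b j" "hemi r (F j) \<noteq> hemi r (F (Suc j))" by blast
    have xr: "b (x j) = r"
    proof (rule ccontr)
      assume "b (x j) \<noteq> r"
      then have "hemi r (F j) = hemi r (F (Suc j))"
        using Fx[OF less.prems] by (intro hemi_cong) auto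
      then show False using r by blast
    qed
    show ?case
    proof (rule ccontr)
      assume neq: "b (x j) \<noteq> b j"
      let ?B = "{i. i < N \<and> b i = r}"
      have lt: "i < j" if "i \<in> ?B" for i
        using that neq xr r(1) b_mono[of j i] by (cases "i < j") auto
      have "x ` ?B \<subseteq> ?B" using less.IH lt x(1) by auto
      moreover have "inj_on x ?B" using inj by (rule inj_on_subset) auto
      ultimately have eq: "x ` ?B = ?B" by (intro endo_inj_surj) auto
      have "x j \<in> x ` ?B" unfolding eq using xr x(1) less.prems by simp
      then obtain i where "i \<in> ?B" "x j = x i" by (rule imageE)
      then show False using inj_onD[OF inj, of i j] lt less.prems by auto
    qed
  qed
  have "x ` {..<N} = {..<N}" using x(1) inj by (intro endo_inj_surj) auto
  then have surj: "\<exists>t<N. x t = i \<and> b t = b i" if "i < N" for i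
  proof -
    have "i \<in> x ` {..<N}" using that \<open>x ` {..<N} = {..<N}\<close> by simp
    then obtain t where "t < N" "i = x t" by auto
    then show ?thesis using bx by auto
  qed
  have past: "hemi r (F j) = 0" if "j \<le> N" "\<And>i. i < N \<Longrightarrow> b i = r \<Longrightarrow> i < j" for r j
  proof (rule hemi_interior)
    have "\<bar>F j i\<bar> \<noteq> 2 * M" if i: "i < N" "b i = r" for i
    proof -
      obtain t where t: "t < N" "x t = i" "b t = b i" using surj[OF i(1)] by blast
      then have "odd (F j i)"
        using odd_after[of t j] i \<open>j \<le> N\<close> \<open>\<And>i. i < N \<Longrightarrow> b i = r \<Longrightarrow> i < j\<close> by auto
      then show ?thesis by presburger
    qed
    then show "\<not> on_bd r (F j)" by (auto simp: on_bd_def)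
  qed
  have hemi_step: "hemi (b j) (F j) \<noteq> hemi (b j) (F (Suc j))" if j: "j < N" for j
  proof -
    have "base j (F i) = hemi (b j) (F i)" if "j \<le> i" "i \<le> N" for i
    proof -
      have "hemi r (F i) = 0" if "r < b j" for r
      proof (rule past[OF \<open>i \<le> N\<close>])
        show "i' < i" if "i' < N" "b i' = r" for i'
          using that \<open>r < b j\<close> \<open>j \<le> i\<close> b_mono[of j i'] by (cases "i' < j") auto
      qed
      then show ?thesis unfolding base_def by (auto intro: sum.neutral)
    qed
    then show ?thesis using ne[OF j] j by simp
  qed
  have hemi_val: "hemi (b i) (F i) = of_bool (odd (Suc (hi i) - i))" if i: "i < N" for i
  proof -
    have "i \<le> hi i" using hi_props(3)[OF i] i by simp
    then show ?thesis using i
    proof (induction "hi i - i" arbitrary: i)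
      case 0
      then have "i = hi i" by simp
      then have "hemi (b i) (F (Suc i)) = 0"
        using hi_props[OF \<open>i < N\<close>] \<open>i < N\<close> by (intro past) (auto simp: less_Suc_eq_le)
      then show ?case using hemi_step[OF \<open>i < N\<close>] \<open>i = hi i\<close> by simp
    next
      case (Suc n)
      then have ne: "i \<noteq> hi i" by simp
      note S = Suc_block[OF \<open>i < N\<close> ne]
      have h: "hi (Suc i) = hi i" using S(2) block_cong by blast
      have "hemi (b i) (F (Suc i)) = of_bool (odd (Suc (hi i) - Suc i))"
        using Suc.hyps(1)[of "Suc i"] Suc.hyps(2) h S by simp
      then show ?case using hemi_step[OF \<open>i < N\<close>] S(3) by (auto simp: Suc_diff_le)
    qed
  qed
  have block: "F j i = base_flag j i" if j: "j \<le> N" and i: "i < N" for i j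
  proof -
    define p q r where "p = lo i" "q = hi i" "r = b i"
    note pqr = this
    have p: "p \<le> i" "p < N" and q: "i \<le> q" "q < N"
      using lo_le[of i] hi_props[OF i] i unfolding pqr by auto
    have inblock: "n < N \<and> b n = r \<and> hi n = q \<and> lo n = p" if "p \<le> n" "n \<le> q" for n
    proof -
      have "n < N" using that q by simp
      moreover from this have "b n = b i" using that block_iff[of n i] i unfolding pqr by simp
      ultimately show ?thesis using block_cong[of n i] unfolding pqr by simp
    qed
    have blockin: "p \<le> n \<and> n \<le> q" if "n < N" "b n = r" for n
      using that block_iff[of n i] i unfolding pqr by simp
    have hv: "hemi r (F n) = of_bool (odd (Suc q - n))" if "p \<le> n" "n \<le> q" for n
      using inblock[OF that] hemi_val[of n] by simp
    \<comment> \<open>Just before the last step of the block \<open>hemi\<close> is 1, so the cell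
      is on the boundary. The coordinate \<open>y\<close> responsible is still even, hence moved in
      step \<open>q\<close>, and keeps all earlier members on the boundary as well.\<close>
    have "hemi r (F q) = 1" using hv[of q] p q by simp
    then have "on_bd r (F q)" using hemi_interior by fastforce
    then obtain y where y: "y < N" "b y = r" "\<bar>F q y\<bar> = 2 * M" by (auto simp: on_bd_def)
    have ev: "even (F q y)" using y(3) by (metis dvd_abs_iff dvd_triv_left)
    have xq: "x q = y"
    proof -
      obtain t where t: "t < N" "x t = y" "b t = b y" using surj[OF y(1)] by blast
      then have "t \<le> q" using blockin[of t] y by simp
      then have "t = q" using odd_after[of t q] ev q t by (cases "t < q") auto
      then show ?thesis using t by simp
    qed
    have y_keep: "F n y = F q y" if "n \<le> q" for n
      using flag_even[OF F that _ ev] q by simp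
    have bd: "on_bd r (F n)" if "n \<le> q" for n
      using y y_keep[OF that] by (auto simp: on_bd_def)
    \<comment> \<open>If coordinate \<open>Suc n\<close> were nonzero at time \<open>n\<close>, it
      would be the last nonzero one of the block before and after step \<open>n\<close>, with the
      same sign, and \<open>hemi\<close> would not change.\<close>
    have zeros: "\<forall>m. n < m \<and> m \<le> q \<longrightarrow> F n m = 0" if "p \<le> n" "n \<le> q" for n
      using that(2,1)
    proof (induction n rule: inc_induct)
      case (step n)
      have Z: "F (Suc n) m = 0" if "Suc n < m" "m \<le> q" for m
        using step.IH step.prems that by simp
      have nq: "Suc n \<le> q" "n < N" "Suc n \<le> N" using step.hyps q by auto
      have "F n (Suc n) = 0"
      proof (rule ccontr)
        assume nz: "F n (Suc n) \<noteq> 0"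
        have sgn: "F (Suc n) (Suc n) \<noteq> 0 \<and> (0 < F (Suc n) (Suc n) \<longleftrightarrow> 0 < F n (Suc n))"
        proof (cases "x n = Suc n")
          case True
          obtain w where "F n (Suc n) = 2 * w" using x(2)[OF nq(2)] True by (auto elim: evenE)
          then show ?thesis using Fx[OF nq(2)] True nz d[OF nq(2)] by auto
        qed (use Fx[OF nq(2)] nz in auto)
        have sb: "Suc n < N" "b (Suc n) = r" using inblock[of "Suc n"] nq step.prems by auto
        have "hemi r (F n) = of_bool (0 < F n (Suc n))"
        proof (rule hemi_eq[OF bd sb nz])
          show "n \<le> q" using nq by simp
          fix m assume m: "Suc n < m" "m < N" "b m = r"
          then have "F (Suc n) m = 0" using Z blockin by blast
          then show "F n m = 0" using flag_even[OF F, of n "Suc n" m] nq by simp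
        qed
        moreover have "hemi r (F (Suc n)) = of_bool (0 < F (Suc n) (Suc n))"
          by (rule hemi_eq[OF bd[OF nq(1)] sb]) (use sgn Z blockin in auto)
        moreover have "hemi r (F n) \<noteq> hemi r (F (Suc n))"
          using hemi_step[OF nq(2)] inblock[of n] nq step.prems by simp
        ultimately show False using sgn by simp
      qed
      moreover have "F n m = 0" if "Suc n < m" "m \<le> q" for m
        using flag_even[OF F, of n "Suc n" m] Z[OF that] nq by simp
      ultimately show ?case by (metis Suc_lessI)
    qed simp
    have early: "F n m = 0" if "p < m" "m \<le> q" "n < m" for n m
    proof -
      have "F (m - 1) m = 0" using zeros[of "m - 1"] that by auto
      then show ?thesis using flag_even[OF F, of n "m - 1" m] that q by simp
    qed
    have "y = p"
    proof (rule ccontr)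
      assume "y \<noteq> p"
      then have "F 0 y = 0" using early[of y 0] blockin[of y] y by auto
      then show False using y_keep[of 0] y M_pos by simp
    qed
    \<comment> \<open>Coordinate \<open>m\<close> is still 0 at time \<open>m - 1\<close>, so it has
      not moved before. The steps from \<open>m\<close> on move later coordinates of the block, and
      step \<open>q\<close> moves \<open>p\<close>.\<close>
    have xS: "x (m - 1) = m" if "p < m" "m \<le> q" for m
      using that
    proof (induction "q - m" arbitrary: m rule: less_induct)
      case less
      obtain t where t: "t < N" "x t = m" "b t = r"
        using surj[of m] inblock[of m] less.prems by auto
      then have pt: "p \<le> t" "t \<le> q" using blockin by auto
      have "t \<noteq> q" using xq \<open>y = p\<close> t less.prems by auto
      moreover have "m - 1 \<le> N" using less.prems q by linarith
      then have "\<not> t < m - 1"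
        using odd_after[of t "m - 1"] early[of m "m - 1"] less.prems t q by auto
      moreover have "\<not> m \<le> t"
      proof
        assume mt: "m \<le> t"
        then have "q - Suc t < q - m" "p < Suc t" "Suc t \<le> q"
          using pt \<open>t \<noteq> q\<close> by linarith+
        then have "x t = Suc t" using less.hyps[of "Suc t"] by simp
        then show False using t mt by simp
      qed
      ultimately have "t = m - 1" by linarith
      then show ?case using t by simp
    qed
    show ?thesis
    proof (cases "i = p")
      case True
      have sg: "sgn_at i = (if odd (Suc q - p) then 1 else -1)"
        unfolding sgn_at_def pqr(2) True ..
      have lohi: "lo i = i" "hi i = q" using True pqr by metis+
      have Fp: "F n i = F q i" if "n \<le> q" for n
        using y_keep[OF that] \<open>y = p\<close> True by simp
      have "F p p \<noteq> 0" using Fp[of p] p q y \<open>y = p\<close> True M_pos by auto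
      then have "hemi r (F p) = of_bool (0 < F p p)"
        using inblock[of p] p q early[of _ p] blockin by (intro hemi_eq bd) auto
      then have "0 < F q i \<longleftrightarrow> odd (Suc q - p)"
        using hv[of p] Fp[of p] p q True by (auto split: if_splits)
      then have Fq: "F q i = sgn_at i * (2 * M)"
      proof -
        have "\<bar>F q i\<bar> = 2 * M" using y(3) \<open>y = p\<close> True by simp
        with \<open>0 < F q i \<longleftrightarrow> odd (Suc q - p)\<close> show ?thesis
          unfolding sg using M_pos
          by (cases "odd (Suc q - p)"; simp only: if_True if_False simp_thms; linarith)
      qed
      show ?thesis
      proof (cases "j \<le> q")
        case True
        then show ?thesis using Fp[OF True] Fq j i lohi by (simp add: base_flag_def)
      next
        case False
        have xi: "x q = i" using xq \<open>y = p\<close> \<open>i = p\<close> by simp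
        have "F (Suc q) i = F q i + d q" using Fx[OF q(2)] xi by simp
        moreover have "\<bar>F (Suc q) i\<bar> \<le> 2 * M"
          using flagsD(1)[OF F, of "Suc q"] q i by (simp add: cell_bound)
        ultimately have "F (Suc q) i = sgn_at i * (2 * M - 1)"
        proof -
          assume *: "F (Suc q) i = F q i + d q" "\<bar>F (Suc q) i\<bar> \<le> 2 * M"
          consider "d q = 1" | "d q = -1" using d[OF q(2)] by linarith
          then show ?thesis
            using * M_pos unfolding Fq sg by cases (auto split: if_splits)
        qed
        moreover have "F j i = F (Suc q) i"
          using flag_odd[OF F, of "Suc q" j i] odd_after[of q "Suc q"] xi False j q by simp
        ultimately show ?thesis
          using False j i lohi by (simp add: base_flag_def)
      qed
    next
      case False
      then have pi: "p < i" using p by simp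
      have lo_i: "lo i \<noteq> i" using pi pqr(1) by simp
      show ?thesis
      proof (cases "j < i")
        case True
        then show ?thesis using early[OF pi q(1) True] lo_i by (simp add: base_flag_def)
      next
        case False
        have i1: "i - 1 < N" "Suc (i - 1) = i" using i pi by auto
        have "x (i - 1) = i" using xS[OF pi q(1)] .
        then have Fi: "F i i = d (i - 1)"
          using Fx[OF i1(1)] early[OF pi q(1), of "i - 1"] i1 pi by simp
        have di: "\<bar>d (i - 1)\<bar> = 1" using d[OF i1(1)] .
        have "hemi r (F i) = of_bool (0 < F i i)"
          using inblock[of i] p q early[of _ i] blockin Fi di pi by (intro hemi_eq bd) auto
        then have "0 < F i i \<longleftrightarrow> odd (Suc q - i)"
          using hv[of i] p q by (auto split: if_splits)
        then have "F i i = sgn_at i" using Fi di unfolding sgn_at_def pqr(2) by auto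
        moreover have "F j i = F i i"
          using flag_odd[OF F, of i j i] odd_after[of "i - 1" i] \<open>x (i - 1) = i\<close> False j i pi by simp
        ultimately show ?thesis using False j i lo_i by (simp add: base_flag_def)
      qed
    qed
  qed
  show ?thesis
  proof (intro ext)
    fix j i
    show "F j i = base_flag j i"
      using block[of j i] flagsD(1)[OF F, of j] flagsD(2)[OF F, of j]
      by (cases "j \<le> N"; cases "i < N") (auto simp: base_flag_def cell_def)
  qed
qed

lemma Phi_base: "Phi base = 1"
proof -
  have zero: "(\<Prod>j<N. base j (F j) + base j (F (Suc j))) = 0" if F: "F \<in> flags - {base_flag}" for F
  proof -
    obtain j where "j < N" "base j (F j) = base j (F (Suc j))" using flag_unique F by blast
    then show ?thesis by (intro prod_zero) auto
  qed
  have "(\<Prod>j<N. base j (base_flag j) + base j (base_flag (Suc j))) = 1"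
    by (rule prod.neutral) (use base_flag_base in \<open>auto simp: bit_add_eq_1_iff simp del: bit_not_one_iff\<close>)
  then show ?thesis
    unfolding Phi_def using zero
    by (subst sum.remove[OF finite_flags base_flag_flags]) (simp add: sum.neutral)
qed

section \<open>Cells with sign changes on their faces\<close>

definition face :: "(nat \<Rightarrow> int) \<Rightarrow> (nat \<Rightarrow> int) \<Rightarrow> bool" where
  "face c c' \<longleftrightarrow> (\<forall>i. c i = c' i \<or> even (c i) \<and> odd (c' i) \<and> \<bar>c i - c' i\<bar> = 1)"

lemma face_trans: "face c c' \<Longrightarrow> face c' c'' \<Longrightarrow> face c c''"
  unfolding face_def by metis

lemma face_step: "step c c' \<Longrightarrow> face c c'"
  by (erule stepE) (auto simp: face_def; presburger)

text \<open>
  Otherwise label a cell by the least \<open>j\<close> such that \<open>u j\<close> has no sign change on its faces. Labels increase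
  along a flag \<open>F\<close> with \<open>N + 1\<close> members but only \<open>N\<close> labels, so that \<open>F n\<close> and \<open>F (n + 1)\<close> both have
  label \<open>n\<close> for some \<open>n\<close>, and the \<open>n\<close>-th factor of every summand of \<open>Phi\<close> is zero.
\<close>

lemma exists_unlabelled_cell:
  fixes u :: "nat \<Rightarrow> (nat \<Rightarrow> int) \<Rightarrow> real"
  assumes u: "\<And>j r c. j < N \<Longrightarrow> cell c \<Longrightarrow> on_bd r c \<Longrightarrow>
    u j (flip r c) = (if e j r = 1 then - u j c else u j c)"
  shows "\<exists>c. cell c \<and> (\<forall>j<N. \<exists>c'. cell c' \<and> face c' c \<and> u j c' * u j c \<le> 0)"
proof (rule ccontr)
  assume contra: "\<not> ?thesis"
  define good where "good j c \<longleftrightarrow> (\<forall>c'. cell c' \<longrightarrow> face c' c \<longrightarrow> 0 < u j c' * u j c)" for j c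
  define lab where "lab c = (LEAST j. good j c)" for c
  have ex: "\<exists>j<N. good j c" if "cell c" for c
    using contra that unfolding good_def by (meson not_le)
  then have lab: "lab c < N \<and> good (lab c) c" if c: "cell c" for c
  proof -
    obtain j where j: "j < N" "good j c" using ex[OF c] by blast
    have "good (lab c) c" unfolding lab_def using j(2) by (rule LeastI)
    moreover have "lab c \<le> j" unfolding lab_def using j(2) by (rule Least_le)
    ultimately show ?thesis using j(1) by simp
  qed
  have good_face: "good j c" if c: "cell c" "face c c'" and g: "good j c'" for j c c'
    unfolding good_def
  proof (intro allI impI)
    fix c'' assume *: "cell c''" "face c'' c"
    have "0 < u j c'' * u j c'" "0 < u j c * u j c'"
      using g c * face_trans unfolding good_def by blast+
    then show "0 < u j c'' * u j c" by (auto simp: zero_less_mult_iff)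
  qed
  \<comment> \<open>Where \<open>u j\<close> vanishes it has no sign, and the bit is filled in from
    \<open>base j\<close>, which has the same parities; so \<open>s j\<close> is equivariant
    everywhere.\<close>
  define s where "s j c = (if u j c = 0 then base j c else of_bool (u j c < 0))" for j c
  have "equivariant (e j) (s j)" if j: "j < N" for j
    unfolding equivariant_def
  proof (intro allI impI)
    fix r c assume *: "cell c" "on_bd r c"
    show "s j (flip r c) = s j c + e j r"
      using u[OF j *] equivariant_base[OF j] * unfolding s_def equivariant_def
      by (cases "e j r") auto
  qed
  then have "Phi s = 1" using Phi_eq[of s base] equivariant_base Phi_base by simp
  moreover have "Phi s = 0"
    unfolding Phi_def
  proof (rule sum.neutral, rule ballI)
    fix F assume F: "F \<in> flags"
    define L where "L j = lab (F j)" for j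
    have cellF: "cell (F j)" if "j \<le> N" for j using flagsD(1)[OF F that] .
    have faceF: "face (F j) (F (Suc j))" if "j < N" for j
      using flagsD(4)[OF F that] by (rule face_step)
    have mono: "L j \<le> L (Suc j)" if "j < N" for j
      unfolding L_def lab_def[of "F j"]
      by (rule Least_le) (use good_face[OF cellF faceF] lab[OF cellF] that in \<open>auto simp: L_def\<close>)
    have N: "L N < N" using lab[OF cellF[of N]] unfolding L_def by blast
    define m where "m = (LEAST j. L j < j)"
    have m: "L m < m" unfolding m_def using N by (rule LeastI)
    have mN: "m \<le> N" unfolding m_def using N by (rule Least_le)
    have min: "\<not> L j < j" if "j < m" for j using that unfolding m_def by (rule not_less_Least)
    obtain n where n: "m = Suc n" using m by (cases m) auto
    have "L n = n" "L (Suc n) = n" "n < N" using m mN min[of n] mono[of n] n by auto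
    then have "good n (F (Suc n))" "face (F n) (F (Suc n))"
      using lab[OF cellF[of "Suc n"]] faceF by (auto simp: L_def)
    then have "0 < u n (F n) * u n (F (Suc n))"
      using cellF[of n] \<open>n < N\<close> by (auto simp: good_def)
    then have "s n (F n) = s n (F (Suc n))" by (auto simp: s_def zero_less_mult_iff)
    then show "(\<Prod>j<N. s j (F j) + s j (F (Suc j))) = 0"
      using \<open>n < N\<close> by (intro prod_zero) auto
  qed
  ultimately show False by simp
qed

end

subsection \<open>A Borsuk-Ulam theorem for products of spheres\<close>

lemma tendsto_fun_iff:
  fixes f :: "'a \<Rightarrow> 'b \<Rightarrow> 'c::topological_space"
  shows "(f \<longlongrightarrow> l) F \<longleftrightarrow> (\<forall>i. ((\<lambda>x. f x i) \<longlongrightarrow> l i) F)"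
  using limitin_componentwise[of "\<lambda>_. euclidean" UNIV f l F]
  by (simp add: euclidean_product_topology)

lemma compact_fun_box: "compact {y :: 'a \<Rightarrow> real. \<forall>i. \<bar>y i\<bar> \<le> 1}"
proof -
  have "compactin (product_topology (\<lambda>_. euclidean) UNIV) (PiE UNIV (\<lambda>_::'a. {-1..1::real}))"
    unfolding compactin_PiE by simp
  moreover have "PiE UNIV (\<lambda>_::'a. {-1..1::real}) = {y. \<forall>i. \<bar>y i\<bar> \<le> 1}"
    by (auto simp: PiE_UNIV_domain abs_le_iff minus_le_iff)
  ultimately show ?thesis by (simp add: euclidean_product_topology)
qed

text \<open>Ever finer grids contain cells near which no \<open>f j\<close> keeps a strict sign. By
  compactness such cells accumulate at a point, which is a common zero by continuity.\<close>

theorem block_borsuk_ulam_nat: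
  fixes f :: "nat \<Rightarrow> (nat \<Rightarrow> real) \<Rightarrow> real" and b :: "nat \<Rightarrow> nat"
  assumes b_mono: "\<And>i j. i \<le> j \<Longrightarrow> j < N \<Longrightarrow> b i \<le> b j"
    and e_own: "\<And>j. j < N \<Longrightarrow> e j (b j) = 1"
    and e_later: "\<And>j r. j < N \<Longrightarrow> b j < r \<Longrightarrow> e j r = 0"
    and cont: "\<And>j. j < N \<Longrightarrow> continuous_on {y. \<forall>i. \<bar>y i\<bar> \<le> 1} (f j)"
    and antipodal: "\<And>j r y. j < N \<Longrightarrow> (\<And>i. \<bar>y i\<bar> \<le> 1) \<Longrightarrow> (\<exists>i<N. b i = r \<and> \<bar>y i\<bar> = 1) \<Longrightarrow>
      f j (\<lambda>i. if b i = r then - y i else y i) = (if e j r = (1::bit) then - f j y else f j y)"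
  shows "\<exists>y. (\<forall>i. \<bar>y i\<bar> \<le> 1) \<and> (\<forall>j<N. f j y = 0)"
proof (cases "N = 0")
  case True
  then show ?thesis by (intro exI[of _ "\<lambda>_. 0"]) simp
next
  case False
  let ?Q = "{y :: nat \<Rightarrow> real. \<forall>i. \<bar>y i\<bar> \<le> 1}"
  \<comment> \<open>The centre of the cell \<open>c\<close> in the grid with
    \<open>M = n + 1\<close>, scaled to the unit cube; the factor 2 undoes the encoding of a point
    \<open>a\<close> as \<open>2 * a\<close>.\<close>
  define pt where "pt n c = (\<lambda>i. of_int (c i) / of_int (2 * int (Suc n)) :: real)" for n and c :: "nat \<Rightarrow> int"
  define R where "R n x x' \<longleftrightarrow> x \<in> ?Q \<and>
    (\<forall>j<N. x' j \<in> ?Q \<and> (\<forall>i. \<bar>x' j i - x i\<bar> \<le> 1 / Suc n) \<and> f j (x' j) * f j x \<le> 0)" for n x x'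
  have "\<exists>x x'. R n x x'" for n
  proof -
    interpret block_grid N "int (Suc n)" b e
      using False b_mono e_own e_later by unfold_locales auto
    have pt_bd: "\<bar>pt n c i\<bar> = 1 \<longleftrightarrow> \<bar>c i\<bar> = 2 * int (Suc n)" for c i
    proof -
      have "\<bar>pt n c i\<bar> = of_int \<bar>c i\<bar> / of_int (2 * int (Suc n))"
        unfolding pt_def by (simp add: abs_divide)
      then show ?thesis by (simp only: divide_eq_1_iff of_int_eq_iff) simp
    qed
    have pt_Q: "pt n c \<in> ?Q" if "cell c" for c
    proof -
      have "\<bar>c i\<bar> \<le> 2 * int (Suc n)" for i
        using that unfolding cell_def by (cases "i < N") auto
      then have "of_int \<bar>c i\<bar> \<le> (of_int (2 * int (Suc n)) :: real)" for i
        by (simp only: of_int_le_iff)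
      then show ?thesis unfolding pt_def by (auto simp: abs_divide divide_le_eq)
    qed
    have pt_flip: "pt n (flip r c) = (\<lambda>i. if b i = r then - pt n c i else pt n c i)" for r c
      by (auto simp: pt_def flip_def)
    have "f j (pt n (flip r c)) = (if e j r = 1 then - f j (pt n c) else f j (pt n c))"
      if "j < N" "cell c" "on_bd r c" for j r c
    proof -
      have "\<exists>i<N. b i = r \<and> \<bar>pt n c i\<bar> = 1" using that(3) unfolding on_bd_def pt_bd .
      then show ?thesis
        unfolding pt_flip using pt_Q[OF that(2)] by (intro antipodal that(1)) auto
    qed
    then obtain c where c: "cell c"
      and c': "\<And>j. j < N \<Longrightarrow> \<exists>c'. cell c' \<and> face c' c \<and> f j (pt n c') * f j (pt n c) \<le> 0"
      using exists_unlabelled_cell[of "\<lambda>j c. f j (pt n c)"] by blast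
    have "\<bar>pt n c' i - pt n c i\<bar> \<le> 1 / Suc n" if "face c' c" for c' i
    proof -
      have "\<bar>c' i - c i\<bar> \<le> 1" using that unfolding face_def by (metis abs_0 diff_self order_refl zero_le_one)
      then have "of_int \<bar>c' i - c i\<bar> \<le> (1 :: real)" by (metis of_int_1 of_int_le_iff)
      moreover have "\<bar>pt n c' i - pt n c i\<bar> = of_int \<bar>c' i - c i\<bar> / (2 * real (Suc n))"
        by (simp add: pt_def diff_divide_distrib [symmetric] abs_divide)
      ultimately have "\<bar>pt n c' i - pt n c i\<bar> \<le> 2 / (2 * real (Suc n))"
        by (simp only:) (rule divide_right_mono; simp)
      also have "\<dots> = 1 / real (Suc n)" by (simp add: field_simps)
      finally show ?thesis .
    qed
    moreover obtain x' where "\<And>j. j < N \<Longrightarrow> cell (x' j) \<and> face (x' j) c \<and> f j (pt n (x' j)) * f j (pt n c) \<le> 0"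
      using c' by metis
    ultimately have "R n (pt n c) (\<lambda>j. pt n (x' j))"
      using pt_Q c unfolding R_def by blast
    then show ?thesis by blast
  qed
  then obtain X X' where "\<And>n. R n (X n) (X' n)" by metis
  then have X: "\<And>n. X n \<in> ?Q"
    and X': "\<And>n j. j < N \<Longrightarrow> X' n j \<in> ?Q"
    and near: "\<And>n j i. j < N \<Longrightarrow> \<bar>X' n j i - X n i\<bar> \<le> 1 / Suc n"
    and opp: "\<And>n j. j < N \<Longrightarrow> f j (X' n j) * f j (X n) \<le> 0"
    unfolding R_def by blast+
  obtain l \<rho> where l: "l \<in> ?Q" "strict_mono \<rho>" and lim: "(X \<circ> \<rho>) \<longlonglongrightarrow> l"
    using seq_compactE[OF compact_imp_seq_compact[OF compact_fun_box], of X] X by blast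
  have "f j l = 0" if j: "j < N" for j
  proof -
    have lim': "(\<lambda>n. X' (\<rho> n) j) \<longlonglongrightarrow> l"
      unfolding tendsto_fun_iff
    proof
      fix i
      have "(\<lambda>n. 1 / real (Suc (\<rho> n))) \<longlonglongrightarrow> 0"
        using LIMSEQ_subseq_LIMSEQ[OF LIMSEQ_Suc[OF lim_1_over_n] l(2)] by (simp add: o_def)
      then have "(\<lambda>n. X' (\<rho> n) j i - X (\<rho> n) i) \<longlonglongrightarrow> 0"
        by (rule Lim_null_comparison[rotated]) (use near[OF j] in auto)
      moreover have "(\<lambda>n. X (\<rho> n) i) \<longlonglongrightarrow> l i"
        using lim unfolding tendsto_fun_iff by (simp add: o_def)
      ultimately show "(\<lambda>n. X' (\<rho> n) j i) \<longlonglongrightarrow> l i"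
        using tendsto_add by fastforce
    qed
    have "(\<lambda>n. f j (X (\<rho> n))) \<longlonglongrightarrow> f j l"
      by (rule continuous_on_tendsto_compose[OF cont[OF j] _ l(1)]) (use lim X in \<open>auto simp: o_def\<close>)
    moreover have "(\<lambda>n. f j (X' (\<rho> n) j)) \<longlonglongrightarrow> f j l"
      by (rule continuous_on_tendsto_compose[OF cont[OF j] lim' l(1)]) (use X'[OF j] in auto)
    ultimately have "(\<lambda>n. f j (X' (\<rho> n) j) * f j (X (\<rho> n))) \<longlonglongrightarrow> f j l * f j l"
      by (intro tendsto_mult)
    \<comment> \<open>Products that are at most 0 tend to a square.\<close>
    then have "f j l * f j l \<le> 0"
      using opp[OF j] by (intro LIMSEQ_le_const2) auto
    then show ?thesis by (auto simp: mult_le_0_iff)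
  qed
  then show ?thesis using l(1) by auto
qed

text \<open>Sorting the index set by first components turns the pairs into numbers with monotone
  blocks.\<close>

theorem block_borsuk_ulam:
  fixes I :: "(nat \<times> nat) set" and f :: "nat \<times> nat \<Rightarrow> (nat \<times> nat \<Rightarrow> real) \<Rightarrow> real"
  assumes I: "finite I"
    and e_own: "\<And>p. p \<in> I \<Longrightarrow> e p (fst p) = 1"
    and e_later: "\<And>p r. p \<in> I \<Longrightarrow> fst p < r \<Longrightarrow> e p r = 0"
    and cont: "\<And>p. p \<in> I \<Longrightarrow> continuous_on {z. \<forall>q. \<bar>z q\<bar> \<le> 1} (f p)"
    and antipodal: "\<And>p r z. p \<in> I \<Longrightarrow> (\<And>q. \<bar>z q\<bar> \<le> 1) \<Longrightarrow> (\<exists>q\<in>I. fst q = r \<and> \<bar>z q\<bar> = 1) \<Longrightarrow>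
      f p (\<lambda>q. if fst q = r then - z q else z q) = (if e p r = (1::bit) then - f p z else f p z)"
  shows "\<exists>z. (\<forall>q. \<bar>z q\<bar> \<le> 1) \<and> (\<forall>p\<in>I. f p z = 0)"
proof -
  obtain xs0 where "set xs0 = I" "distinct xs0" using finite_distinct_list[OF I] by blast
  define xs where "xs = sort_key fst xs0"
  define N where "N = length xs"
  have xs: "set xs = I" "distinct xs" "sorted (map fst xs)"
    using \<open>set xs0 = I\<close> \<open>distinct xs0\<close> by (auto simp: xs_def)
  define pos where "pos p = (THE i. i < N \<and> xs ! i = p)" for p
  have pos_nth: "pos (xs ! i) = i" if "i < N" for i
    unfolding pos_def using that xs(2) by (auto simp: N_def nth_eq_iff_index_eq)
  have nth_pos: "pos p < N \<and> xs ! pos p = p" if "p \<in> I" for p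
  proof -
    from that xs(1) have "p \<in> set xs" by simp
    then obtain i where "i < N" "xs ! i = p" unfolding in_set_conv_nth N_def by blast
    then show ?thesis using pos_nth by auto
  qed
  have nth_I: "xs ! i \<in> I" if "i < N" for i using that xs(1) by (auto simp: N_def)
  define \<zeta> where "\<zeta> y p = (if p \<in> I then y (pos p) else 0)" for y :: "nat \<Rightarrow> real" and p
  have \<zeta>_Q: "\<bar>\<zeta> y p\<bar> \<le> 1" if "\<And>i. \<bar>y i\<bar> \<le> 1" for y p using that by (simp add: \<zeta>_def)
  have "\<exists>y. (\<forall>i. \<bar>y i\<bar> \<le> 1) \<and> (\<forall>j<N. f (xs ! j) (\<zeta> y) = 0)"
  proof (rule block_borsuk_ulam_nat)
    show "fst (xs ! i) \<le> fst (xs ! j)" if "i \<le> j" "j < N" for i j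
      using sorted_nth_mono[OF xs(3) that(1)] that by (auto simp: N_def)
    show "e (xs ! j) (fst (xs ! j)) = 1" if "j < N" for j using e_own nth_I that by blast
    show "e (xs ! j) r = 0" if "j < N" "fst (xs ! j) < r" for j r using e_later nth_I that by blast
    show "continuous_on {y. \<forall>i. \<bar>y i\<bar> \<le> 1} (\<lambda>y. f (xs ! j) (\<zeta> y))" if "j < N" for j
    proof (rule continuous_on_compose2[OF cont[OF nth_I[OF that]]])
      show "continuous_on {y. \<forall>i. \<bar>y i\<bar> \<le> 1} \<zeta>"
      proof (rule continuous_on_coordinatewise_then_product)
        fix p
        show "continuous_on {y. \<forall>i. \<bar>y i\<bar> \<le> 1} (\<lambda>y. \<zeta> y p)"
          by (cases "p \<in> I")
            (auto simp: \<zeta>_def intro: continuous_on_subset[OF continuous_on_product_coordinates])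
      qed
    qed (use \<zeta>_Q in auto)
    fix j r and y :: "nat \<Rightarrow> real"
    assume j: "j < N" and y: "\<And>i. \<bar>y i\<bar> \<le> 1" and bd: "\<exists>i<N. fst (xs ! i) = r \<and> \<bar>y i\<bar> = 1"
    have "\<zeta> (\<lambda>i. if fst (xs ! i) = r then - y i else y i) = (\<lambda>q. if fst q = r then - \<zeta> y q else \<zeta> y q)"
      using nth_pos by (auto simp: \<zeta>_def)
    moreover have "\<exists>q\<in>I. fst q = r \<and> \<bar>\<zeta> y q\<bar> = 1"
      using bd nth_I pos_nth by (auto simp: \<zeta>_def)
    ultimately show "f (xs ! j) (\<zeta> (\<lambda>i. if fst (xs ! i) = r then - y i else y i))
      = (if e (xs ! j) r = 1 then - f (xs ! j) (\<zeta> y) else f (xs ! j) (\<zeta> y))"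
      using antipodal[OF nth_I[OF j] \<zeta>_Q[OF y]] by simp
  qed
  then obtain y where y: "\<And>i. \<bar>y i\<bar> \<le> 1" "\<And>j. j < N \<Longrightarrow> f (xs ! j) (\<zeta> y) = 0" by blast
  have "f p (\<zeta> y) = 0" if "p \<in> I" for p using y(2)[of "pos p"] nth_pos[OF that] by simp
  then show ?thesis using \<zeta>_Q[OF y(1)] by (intro exI[of _ "\<zeta> y"]) simp
qed

subsection \<open>Transversal flats\<close>

definition flip_block :: "nat \<Rightarrow> (nat \<times> nat \<Rightarrow> real) \<Rightarrow> nat \<times> nat \<Rightarrow> real" where
  "flip_block r z = (\<lambda>p. if fst p = r then - z p else z p)"

text \<open>
  The last coordinate is a product that vanishes when a coordinate of the cube is \<open>\<plusminus>1\<close>, so that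
  opposite boundary points of the cube go to antipodal points. No normalisation is needed.
\<close>

definition hemisphere :: "nat \<Rightarrow> (nat \<times> nat \<Rightarrow> real) \<Rightarrow> nat \<Rightarrow> nat \<Rightarrow> real" where
  "hemisphere n z r q = (if q < n then z (r, q) else if q = n then \<Prod>q<n. 1 - (z (r, q))\<^sup>2 else 0)"

text \<open>If the first \<open>n\<close> coordinates vanish, the product in the last one is
  1.\<close>

lemma hemisphere_nonzero: "\<exists>q\<le>n. hemisphere n z r q \<noteq> 0"
proof (cases "\<exists>q<n. z (r, q) \<noteq> 0")
  case True
  then show ?thesis by (auto simp: hemisphere_def intro: less_imp_le)
next
  case False
  then show ?thesis by (auto simp: hemisphere_def intro!: exI[of _ n])
qed

lemma hemisphere_flip_other: "r \<noteq> r' \<Longrightarrow> hemisphere n (flip_block r' z) r q = hemisphere n z r q"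
  by (simp add: hemisphere_def flip_block_def)

lemma hemisphere_flip_same:
  assumes "q < n" "\<bar>z (r, q)\<bar> = 1"
  shows "hemisphere n (flip_block r z) r q' = - hemisphere n z r q'"
proof -
  have "(z (r, q))\<^sup>2 = 1" using assms(2) by (metis power2_abs power_one)
  then have "(\<Prod>q<n. 1 - (z (r, q))\<^sup>2) = 0" using assms(1) by (intro prod_zero) auto
  then show ?thesis by (simp add: hemisphere_def flip_block_def)
qed

lemma continuous_on_hemisphere [continuous_intros]:
  "continuous_on A (\<lambda>z. hemisphere n z r q)"
proof -
  have "continuous_on A (\<lambda>z :: nat \<times> nat \<Rightarrow> real. z p)" for p
    by (rule continuous_on_subset[OF continuous_on_product_coordinates]) simp
  then show ?thesis
    unfolding hemisphere_def
    by (cases "q < n"; cases "q = n") (auto intro!: continuous_intros)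
qed

text \<open>As \<open>l i\<close> sums to 0, its positive and negative parts have equal mass.
  Normalised, they give the points \<open>W + U / A\<close> and \<open>W - U / A\<close> in the
  hulls of the two parts of the \<open>i\<close>-th set. The last two conclusions say that
  \<open>U\<close> is orthogonal to all \<open>Y r\<close> and that \<open>W \<bullet> Y r\<close>
  does not depend on \<open>i\<close>, so all these points lie on one flat.\<close>

lemma transversal_coefficients:
  fixes s :: "nat \<Rightarrow> nat \<Rightarrow> 'a::euclidean_space"
  assumes dim: "DIM('a) = m + k"
  obtains Y :: "nat \<Rightarrow> 'a" and l :: "nat \<Rightarrow> nat \<Rightarrow> real"
  where "\<forall>r<m. Y r \<noteq> 0"
    and "\<forall>r<m. \<forall>t<r. Y t \<bullet> Y r = 0"
    and "\<forall>i. (\<Sum>j<m + 2. l i j) = 0"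
    and "\<forall>i. 0 < (\<Sum>j<m + 2. \<bar>l i j\<bar>)"
    and "\<forall>i\<le>k. \<forall>r<m. (\<Sum>j<m + 2. l i j *\<^sub>R s i j) \<bullet> Y r = 0"
    and "\<forall>i\<le>k. \<forall>r<m. ((\<Sum>j<m + 2. \<bar>l i j\<bar> *\<^sub>R s i j) /\<^sub>R (\<Sum>j<m + 2. \<bar>l i j\<bar>)) \<bullet> Y r
      = ((\<Sum>j<m + 2. \<bar>l 0 j\<bar> *\<^sub>R s 0 j) /\<^sub>R (\<Sum>j<m + 2. \<bar>l 0 j\<bar>)) \<bullet> Y r"
proof -
  obtain \<beta> :: "nat \<Rightarrow> 'a" where \<beta>: "bij_betw \<beta> {..<m + k} Basis"
    using ex_bij_betw_nat_finite[of "Basis :: 'a set"] dim by (auto simp: atLeast0LessThan)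
  \<comment> \<open>The dimensions of the spheres: \<open>k + r\<close> for \<open>Y r\<close>, and
    \<open>m\<close> for \<open>l i\<close> in block \<open>m + i\<close>, since vectors with sum 0
    on \<open>m + 2\<close> points form a space of dimension \<open>m + 1\<close>.\<close>
  define n where "n r = (if r < m then k + r else m)" for r
  define I where "I = Sigma {..m + k} (\<lambda>r. {..<n r})"
  define Y where "Y z r = (\<Sum>q\<le>n r. hemisphere (n r) z r q *\<^sub>R \<beta> q)" for z r
  define l where "l z i j = (if j \<le> m then hemisphere m z (m + i) j
    else - (\<Sum>j\<le>m. hemisphere m z (m + i) j))" for z and i j :: nat
  define U where "U z i = (\<Sum>j<m + 2. l z i j *\<^sub>R s i j)" for z i
  define A where "A z i = (\<Sum>j<m + 2. \<bar>l z i j\<bar>)" for z i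
  define W where "W z i = (\<Sum>j<m + 2. \<bar>l z i j\<bar> *\<^sub>R s i j) /\<^sub>R A z i" for z i
  \<comment> \<open>Block \<open>r < m\<close> gets \<open>k\<close> equations between means and
    \<open>r\<close> for orthogonality to the earlier \<open>Y\<close>; block \<open>m + i\<close>
    gets the \<open>m\<close> equations for \<open>U z i\<close>. This matches the dimensions
    \<open>n r\<close>.\<close>
  define f where "f = (\<lambda>(r, q) z. if r < m then
      if q < k then (W z (Suc q) - W z 0) \<bullet> Y z r else Y z (q - k) \<bullet> Y z r
    else U z (r - m) \<bullet> Y z q)"
  \<comment> \<open>Apart from the own block, \<open>U z (r - m) \<bullet> Y z q\<close> is odd in
    block \<open>q\<close> and \<open>Y z (q - k) \<bullet> Y z r\<close> in block
    \<open>q - k\<close>, both earlier. The means \<open>W\<close> are even in every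
    \<open>l\<close> because their weights are absolute values.\<close>
  define e :: "nat \<times> nat \<Rightarrow> nat \<Rightarrow> bit" where
    "e = (\<lambda>(r, q) r'. of_bool (r' = r \<or> r' = q \<and> m \<le> r \<or> r' + k = q \<and> r < m))"
  have A_pos: "0 < A z i" for z i
  proof -
    obtain j where j: "j \<le> m" "hemisphere m z (m + i) j \<noteq> 0" using hemisphere_nonzero by blast
    then have "0 < \<bar>l z i j\<bar>" by (simp add: l_def)
    also have "\<dots> \<le> A z i" unfolding A_def by (rule member_le_sum) (use j in auto)
    finally show ?thesis .
  qed
  have hemi_flip: "hemisphere (n r) (flip_block r' z) r q = (if r = r' then -1 else 1) * hemisphere (n r) z r q"
    if "\<exists>p\<in>I. fst p = r' \<and> \<bar>z p\<bar> = 1" for r r' z q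
    using that hemisphere_flip_other[of r r'] by (auto simp: I_def hemisphere_flip_same)
  have Y_flip: "Y (flip_block r' z) r = (if r = r' then -1 else 1) *\<^sub>R Y z r"
    if "\<exists>p\<in>I. fst p = r' \<and> \<bar>z p\<bar> = 1" for r r' z
    unfolding Y_def hemi_flip[OF that] by (simp add: scaleR_sum_right)
  have l_flip: "l (flip_block r' z) i j = (if m + i = r' then -1 else 1) * l z i j"
    if "\<exists>p\<in>I. fst p = r' \<and> \<bar>z p\<bar> = 1" for i j r' z
  proof -
    have "n (m + i) = m" by (simp add: n_def)
    then show ?thesis
      using hemi_flip[OF that, of "m + i"] by (simp add: l_def sum_negf)
  qed
  have U_flip: "U (flip_block r' z) i = (if m + i = r' then -1 else 1) *\<^sub>R U z i"
    if "\<exists>p\<in>I. fst p = r' \<and> \<bar>z p\<bar> = 1" for r' z i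
    unfolding U_def l_flip[OF that] by (simp add: scaleR_sum_right sum_negf)
  have W_flip: "W (flip_block r' z) i = W z i"
    if "\<exists>p\<in>I. fst p = r' \<and> \<bar>z p\<bar> = 1" for r' z i
    unfolding W_def A_def l_flip[OF that] by (simp add: abs_mult)
  have contY: "continuous_on C (\<lambda>z. Y z r)" for C r
    unfolding Y_def by (intro continuous_intros)
  have contl: "continuous_on C (\<lambda>z. l z i j)" for C i j
    unfolding l_def by (cases "j \<le> m") (auto intro!: continuous_intros)
  have contU: "continuous_on C (\<lambda>z. U z i)" for C i
    unfolding U_def by (intro continuous_intros contl)
  have contA: "continuous_on C (\<lambda>z. A z i)" for C i
    unfolding A_def by (intro continuous_intros contl)
  have contW: "continuous_on C (\<lambda>z. W z i)" for C i
    unfolding W_def using A_pos by (intro continuous_intros contl contA) (simp add: less_imp_neq[symmetric])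
  have "\<exists>z. (\<forall>q. \<bar>z q\<bar> \<le> 1) \<and> (\<forall>p\<in>I. f p z = 0)"
  proof (rule block_borsuk_ulam)
    show "finite I" by (simp add: I_def)
    show "e p (fst p) = 1" for p by (simp add: e_def split: prod.split)
    show "e p r = 0" if "p \<in> I" "fst p < r" for p r
      using that by (auto simp: e_def I_def n_def)
    show "continuous_on {z. \<forall>q. \<bar>z q\<bar> \<le> 1} (f p)" for p
      by (cases p; cases "fst p < m"; cases "snd p < k")
        (auto simp: f_def intro!: continuous_intros contY contU contW)
    fix p r' and z :: "nat \<times> nat \<Rightarrow> real"
    assume p: "p \<in> I" and bd: "\<exists>q\<in>I. fst q = r' \<and> \<bar>z q\<bar> = 1"
    obtain r q where rq: "p = (r, q)" by force
    show "f p (\<lambda>q. if fst q = r' then - z q else z q) = (if e p r' = 1 then - f p z else f p z)"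
      using p unfolding flip_block_def [symmetric] rq
      by (auto simp: f_def e_def I_def n_def Y_flip[OF bd] U_flip[OF bd] W_flip[OF bd])
  qed
  then obtain z where z: "\<And>p. p \<in> I \<Longrightarrow> f p z = 0" by blast
  show ?thesis
  proof (rule that[of "Y z" "l z"]; intro allI impI)
    fix r assume r: "r < m"
    show "Y z r \<noteq> 0"
    proof -
      obtain q where q: "q \<le> n r" "hemisphere (n r) z r q \<noteq> 0" using hemisphere_nonzero by blast
      have lt: "q' < m + k" if "q' \<le> n r" for q' using that r by (simp add: n_def)
      have "Y z r \<bullet> \<beta> q = (\<Sum>q'\<le>n r. if q' = q then hemisphere (n r) z r q' else 0)"
        unfolding Y_def inner_sum_left
      proof (rule sum.cong)
        fix q' assume "q' \<in> {..n r}"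
        then have "\<beta> q' \<in> Basis" "\<beta> q \<in> Basis" "\<beta> q' = \<beta> q \<longleftrightarrow> q' = q"
          using \<beta> lt[of q'] lt[OF q(1)] by (auto simp: bij_betw_def inj_on_def)
        then show "hemisphere (n r) z r q' *\<^sub>R \<beta> q' \<bullet> \<beta> q = (if q' = q then hemisphere (n r) z r q' else 0)"
          by (simp add: inner_Basis)
      qed simp
      then have "Y z r \<bullet> \<beta> q \<noteq> 0" using q by simp
      then show ?thesis by auto
    qed
  next
    show "Y z t \<bullet> Y z r = 0" if "t < r" "r < m" for t r
      using z[of "(r, k + t)"] that by (simp add: I_def n_def f_def)
    show "(\<Sum>j<m + 2. l z i j) = 0" for i
    proof -
      have "{..<m + 2} = insert (Suc m) {..m}" by auto
      then show ?thesis by (simp add: l_def)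
    qed
    show "0 < (\<Sum>j<m + 2. \<bar>l z i j\<bar>)" for i using A_pos[of z i] by (simp add: A_def)
    show "(\<Sum>j<m + 2. l z i j *\<^sub>R s i j) \<bullet> Y z r = 0" if "i \<le> k" "r < m" for i r
      using z[of "(m + i, r)"] that by (simp add: I_def n_def f_def U_def)
    fix i r assume ir: "i \<le> k" "r < m"
    have "W z i \<bullet> Y z r = W z 0 \<bullet> Y z r"
    proof (cases i)
      case (Suc q)
      then show ?thesis
        using z[of "(r, q)"] ir by (simp add: I_def n_def f_def inner_diff_left)
    qed simp
    then show "((\<Sum>j<m + 2. \<bar>l z i j\<bar> *\<^sub>R s i j) /\<^sub>R (\<Sum>j<m + 2. \<bar>l z i j\<bar>)) \<bullet> Y z r
      = ((\<Sum>j<m + 2. \<bar>l z 0 j\<bar> *\<^sub>R s 0 j) /\<^sub>R (\<Sum>j<m + 2. \<bar>l z 0 j\<bar>)) \<bullet> Y z r"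
      by (simp only: W_def A_def)
  qed
qed

section \<open>The flat and the splittings\<close>

text \<open>Pairwise orthogonal nonzero vectors are independent, so the orthogonal complement of
  their span has dimension \<open>k\<close>; the set is its translate by \<open>w\<close>.\<close>

lemma k_flat_orthogonal:
  fixes Y :: "nat \<Rightarrow> 'a::euclidean_space"
  assumes dim: "DIM('a) = m + k"
    and nz: "\<And>r. r < m \<Longrightarrow> Y r \<noteq> 0"
    and orth: "\<And>t r. t < r \<Longrightarrow> r < m \<Longrightarrow> Y t \<bullet> Y r = 0"
  shows "k_flat k {x. \<forall>r<m. x \<bullet> Y r = w \<bullet> Y r}"
proof -
  have orth': "Y t \<bullet> Y r = 0" if "t \<noteq> r" "t < m" "r < m" for t r
    using that orth[of t r] orth[of r t] by (auto simp: neq_iff inner_commute)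
  have inj: "inj_on Y {..<m}"
  proof (rule inj_onI)
    fix t r assume *: "t \<in> {..<m}" "r \<in> {..<m}" "Y t = Y r"
    then show "t = r" using orth'[of t r] nz[of r] by (cases "t = r") auto
  qed
  have "pairwise orthogonal (Y ` {..<m})"
  proof (clarsimp simp: pairwise_def orthogonal_def)
    fix t r assume "t < m" "r < m" "Y t \<noteq> Y r"
    then show "Y t \<bullet> Y r = 0" by (intro orth') auto
  qed
  then have "independent (Y ` {..<m})"
    using nz by (intro pairwise_orthogonal_independent) auto
  then have "dim (span (Y ` {..<m})) = m"
    by (simp add: dim_eq_card_independent card_image inj)
  moreover have "dim {y \<in> UNIV. \<forall>x \<in> span (Y ` {..<m}). orthogonal x y} + dim (span (Y ` {..<m}))
    = dim (UNIV :: 'a set)"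
    by (intro dim_subspace_orthogonal_to_vectors) auto
  moreover have "{y \<in> UNIV. \<forall>x \<in> span (Y ` {..<m}). orthogonal x y} = {x. \<forall>r<m. x \<bullet> Y r = 0}" (is "_ = ?V")
  proof (intro set_eqI iffI)
    fix x assume x: "x \<in> ?V"
    have "orthogonal x y" if "y \<in> span (Y ` {..<m})" for y
      using that by (rule orthogonal_to_span) (use x in \<open>auto simp: orthogonal_def\<close>)
    then show "x \<in> {y \<in> UNIV. \<forall>x \<in> span (Y ` {..<m}). orthogonal x y}"
      by (auto simp: orthogonal_commute)
  next
    fix x assume "x \<in> {y \<in> UNIV. \<forall>x \<in> span (Y ` {..<m}). orthogonal x y}"
    then have "orthogonal (Y r) x" if "r < m" for r using that by (auto intro: span_base)
    then show "x \<in> ?V" by (auto simp: orthogonal_def inner_commute)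
  qed
  ultimately have dimV: "dim ?V = k" using dim by simp
  have V: "subspace ?V" by (auto simp: subspace_def inner_add_left)
  have F: "{x. \<forall>r<m. x \<bullet> Y r = w \<bullet> Y r} = (+) w ` ?V" (is "?F = _")
  proof (intro set_eqI iffI)
    fix x assume "x \<in> ?F"
    then show "x \<in> (+) w ` ?V" by (intro image_eqI[of _ _ "x - w"]) (auto simp: inner_diff_left)
  qed (auto simp: inner_add_left)
  show ?thesis
    unfolding k_flat_def F affine_translation [symmetric] aff_dim_translation_eq
    using subspace_imp_affine[OF V] aff_dim_subspace[OF V] dimV by simp
qed

theorem theorem2p1:
  fixes k :: nat
    and S :: "nat \<Rightarrow> (real ^ 'n) set"
  assumes "k \<le> CARD('n) - 1"
    and "\<And>i. i \<le> k \<Longrightarrow> finite (S i)"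
    and "\<And>i. i \<le> k \<Longrightarrow> card (S i) = CARD('n) - k + 2"
  shows "\<exists>T :: nat \<Rightarrow> nat \<Rightarrow> (real ^ 'n) set.
           (\<forall>i\<le>k. S i = T i 1 \<union> T i 2 \<and> T i 1 \<inter> T i 2 = {}) \<and>
           (\<exists>F. k_flat k F \<and> (\<forall>i\<le>k. \<forall>j\<in>{1, 2}. F \<inter> convex hull (T i j) \<noteq> {}))"
proof -
  define m where "m = CARD('n) - k"
  have "0 < CARD('n)" by simp
  then have dim: "DIM(real ^ 'n) = m + k" using assms(1) by (simp add: m_def)
  have "\<exists>h. bij_betw h {..<m + 2} (S i)" if "i \<le> k" for i
    using ex_bij_betw_nat_finite[OF assms(2)[OF that]] assms(3)[OF that]
    by (simp add: m_def atLeast0LessThan)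
  then obtain s where s: "\<And>i. i \<le> k \<Longrightarrow> bij_betw (s i) {..<m + 2} (S i)" by metis
  obtain Y :: "nat \<Rightarrow> real ^ 'n" and l where Y: "\<forall>r<m. Y r \<noteq> 0" "\<forall>r<m. \<forall>t<r. Y t \<bullet> Y r = 0"
    and l: "\<forall>i. (\<Sum>j<m + 2. l i j) = 0" "\<forall>i. 0 < (\<Sum>j<m + 2. \<bar>l i j\<bar>)"
    and U: "\<forall>i\<le>k. \<forall>r<m. (\<Sum>j<m + 2. l i j *\<^sub>R s i j) \<bullet> Y r = 0"
    and W: "\<forall>i\<le>k. \<forall>r<m. ((\<Sum>j<m + 2. \<bar>l i j\<bar> *\<^sub>R s i j) /\<^sub>R (\<Sum>j<m + 2. \<bar>l i j\<bar>)) \<bullet> Y r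
      = ((\<Sum>j<m + 2. \<bar>l 0 j\<bar> *\<^sub>R s 0 j) /\<^sub>R (\<Sum>j<m + 2. \<bar>l 0 j\<bar>)) \<bullet> Y r"
    by (rule transversal_coefficients[OF dim, of s])
  \<comment> \<open>Any of the means could be the base point; by \<open>W\<close> all have the same
    products with the \<open>Y r\<close>.\<close>
  define w where "w = (\<Sum>j<m + 2. \<bar>l 0 j\<bar> *\<^sub>R s 0 j) /\<^sub>R (\<Sum>j<m + 2. \<bar>l 0 j\<bar>)"
  define F where "F = {x. \<forall>r<m. x \<bullet> Y r = w \<bullet> Y r}"
  have meets: "F \<inter> convex hull (s i ` {j. j < m + 2 \<and> 0 < \<sigma> * l i j}) \<noteq> {}"
    if i: "i \<le> k" and \<sigma>: "\<bar>\<sigma>\<bar> = 1" for i and \<sigma> :: real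
  proof -
    define A where "A = (\<Sum>j<m + 2. \<bar>l i j\<bar>)"
    have A: "0 < A" using l(2) by (simp add: A_def)
    \<comment> \<open>Twice the positive part of \<open>\<sigma> * l i j\<close>, divided by
      \<open>A\<close>. As \<open>l i\<close> sums to 0, these weights add up to 1.\<close>
    define c where "c j = (\<bar>l i j\<bar> + \<sigma> * l i j) / A" for j
    define a where "a = (\<Sum>j<m + 2. c j *\<^sub>R s i j)"
    let ?J = "{j. j < m + 2 \<and> 0 < \<sigma> * l i j}"
    have c0: "c j = 0" if "\<not> 0 < \<sigma> * l i j" for j
      using that \<sigma> by (auto simp: c_def abs_if split: if_splits)
    have c_nonneg: "0 \<le> c j" for j
    proof -
      have "0 \<le> \<bar>l i j\<bar> + \<sigma> * l i j"
        using \<sigma> by (auto simp: abs_if split: if_splits)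
      then show ?thesis unfolding c_def using A by (intro divide_nonneg_pos)
    qed
    have restrict: "(\<Sum>j<m + 2. g j) = (\<Sum>j\<in>?J. g j)" if "\<And>j. \<not> 0 < \<sigma> * l i j \<Longrightarrow> g j = 0"
      for g :: "nat \<Rightarrow> 'b::comm_monoid_add"
      using that by (intro sum.mono_neutral_right) auto
    have "(\<Sum>j<m + 2. c j) = 1"
      using l(1) A
      by (simp add: c_def sum_divide_distrib [symmetric] sum.distrib sum_distrib_left [symmetric] A_def)
    then have "(\<Sum>j\<in>?J. c j) = 1" using restrict[of c] c0 by simp
    then have "(\<Sum>j\<in>?J. c j *\<^sub>R s i j) \<in> convex hull (s i ` ?J)"
      using c_nonneg by (intro convex_sum) (auto intro: hull_inc)
    moreover have "a = (\<Sum>j\<in>?J. c j *\<^sub>R s i j)" unfolding a_def using c0 by (intro restrict) auto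
    moreover have "a \<in> F"
    proof -
      have a: "a = (\<Sum>j<m + 2. \<bar>l i j\<bar> *\<^sub>R s i j) /\<^sub>R A + (\<sigma> / A) *\<^sub>R (\<Sum>j<m + 2. l i j *\<^sub>R s i j)"
      proof -
        have "c j *\<^sub>R s i j = inverse A *\<^sub>R (\<bar>l i j\<bar> *\<^sub>R s i j) + (\<sigma> / A) *\<^sub>R (l i j *\<^sub>R s i j)" for j
          unfolding c_def add_divide_distrib scaleR_add_left by (simp add: divide_inverse mult.commute)
        then show ?thesis
          by (simp only: a_def sum.distrib scaleR_sum_right)
      qed
      have "a \<bullet> Y r = w \<bullet> Y r" if r: "r < m" for r
      proof -
        have "((\<Sum>j<m + 2. \<bar>l i j\<bar> *\<^sub>R s i j) /\<^sub>R A) \<bullet> Y r = w \<bullet> Y r"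
          using W i r unfolding A_def w_def by blast
        moreover have "(\<Sum>j<m + 2. l i j *\<^sub>R s i j) \<bullet> Y r = 0" using U i r by blast
        ultimately show ?thesis unfolding a inner_add_left inner_scaleR_left by simp
      qed
      then show ?thesis by (simp add: F_def)
    qed
    ultimately show ?thesis by auto
  qed
  \<comment> \<open>Points with coefficient 0 go to the second part, which only enlarges its
    hull.\<close>
  define T where "T i j = (if j = (1::nat) then s i ` {j. j < m + 2 \<and> 0 < l i j}
    else s i ` {j. j < m + 2 \<and> \<not> 0 < l i j})" for i j
  have "S i = T i 1 \<union> T i 2 \<and> T i 1 \<inter> T i 2 = {}" if "i \<le> k" for i
  proof -
    have "inj_on (s i) {..<m + 2}" "S i = s i ` {..<m + 2}"
      using s[OF that] by (auto simp: bij_betw_def)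
    then show ?thesis unfolding T_def by (auto simp: inj_on_def)
  qed
  moreover have "k_flat k F" unfolding F_def using Y by (intro k_flat_orthogonal[OF dim]) auto
  moreover have "F \<inter> convex hull (T i j) \<noteq> {}" if "i \<le> k" "j \<in> {1, 2}" for i j
  proof -
    have "convex hull (s i ` {j. j < m + 2 \<and> 0 < -1 * l i j}) \<subseteq> convex hull (T i 2)"
      by (intro hull_mono) (auto simp: T_def)
    moreover have "convex hull (s i ` {j. j < m + 2 \<and> 0 < 1 * l i j}) = convex hull (T i 1)"
      by (simp add: T_def)
    ultimately show ?thesis using meets[OF that(1), of 1] meets[OF that(1), of "-1"] that(2) by auto
  qed
  ultimately show ?thesis by (intro exI[of _ T]) blast
qed

end
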